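(* Let $0<\epsilon<1$ and let $\mathcal C$ be a real affine plane algebraic curve over $\mathbb C$ defined by an $\epsilon$-irreducible polynomial $f(x,y)\in\mathbb R[x,y]$ of proper degree $d>2$, such that the projective closure $\mathcal C^h$ of $\mathcal C$ has no singularities at infinity and $(1:0:0),(0:1:0)\notin\mathcal C^h$. Assume that $\mathcal C$ is $\epsilon$-rational, and let $\overline{\mathcal C}$ be the rational plane curve parametrized by the output $\overline{\mathcal P}(t)$ of the Approximate Parametrization Algorithm (described in the context) applied to $f$ and $\epsilon$. Then $\overline{\mathcal C}$ and $\mathcal C$ have the same points at infinity, and $\deg(\overline{\mathcal C})\le\deg(\mathcal C)$.
   Context: **Notation.** $\|\cdot\|$ is the $\infty$-norm of a polynomial (maximum modulus of its coefficients), $\|\cdot\|_2$ the unitary norm on $\mathbb C^2$. For $\vec v=(i,j)\in\mathbb N^2$, $|\vec v|=i+j$ and $g^{\vec v}=\partial^{i+j}g/\partial x^i\partial y^j$; $\vec e_1=(1,0)$, $\vec e_2=(0,1)$. $F(x,y,z)$ is the homogenization of $f$. A point at infinity is a point of the projective closure with $z=0$. **Proper degree, $\epsilon$-irreducibility.** $g\in\mathbb C[x,y]$ has proper degree $\ell$ if its total degree is $\ell$ and $|g^{\vec v}|>\epsilon\|g\|$ for some $\vec v$ with $|\vec v|=\ell$. $f$ is $\epsilon$-irreducible if it cannot be written $f=gh+\mathcal E$ with $g,h,\mathcal E\in\mathbb C[x,y]$ and $\|\mathcal E\|<\epsilon\|f\|$ (as usual, $g,h$ non-constant); in particular $f$ is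 irreducible. **$\epsilon$-points.** $P\in\mathbb C^2$ is an $\epsilon$-point of $\mathcal C$ if $|f(P)|<\epsilon\|f\|$. Its $\epsilon$-multiplicity is the smallest $r\in\mathbb N$ such that $|f^{\vec v}(P)|<\epsilon\|f\|$ for all $|\vec v|\le r-1$ and $|f^{\vec v}(P)|\ge\epsilon\|f\|$ for some $|\vec v|=r$. $P$ is $\epsilon$-simple if $r=1$, otherwise an $\epsilon$-singularity. An $\epsilon$-simple point is an $\epsilon$-ramification point if $|f^{\vec e_1}(P)|<\epsilon\|f\|$ or $|f^{\vec e_2}(P)|<\epsilon\|f\|$. $P$ is $k$-pure ($k\in\{1,2\}$) if $r>1$ and $|f^{r\vec e_k}(P)|\ge\epsilon\|f\|$; then $\mathrm{weight}_k(P)=\max_{0\le i\le r-1}\left|\frac{r!\,f^{i\vec e_k}(P)}{i!\,f^{r\vec e_k}(P)}\right|^{1/(r-i)}$, and $\mathrm{weight}(P)$ is the maximum of the $k$-weights over those $k$ for which $P$ is $k$-pure. Put $\mathcal R_{\rm out}(x)=\frac12-\frac{x(1-9x)}{2(1+3x)}-\frac{32x^2}{(1+3x)^3}$; $\mathrm{radius}(P)=\mathcal R_{\rm out}(\mathrm{weight}(P))$ if $P$ is pure and $0$ otherwise. **$\epsilon$-singular locus.** $\mathcal S_1$ is the set of solutions, under fixed precision $\epsilon\|f\|$, of $f=f^{\vec e_1}=f^{\vec e_2}=0$. For $2\le k\le d-1$ choose $\vec u_1,\dots,\vec u_s$ ($2\le s\le k+1$) with $|\vec u_i|=k$ and $\gcd(f^{\vec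 u_1},\dots,f^{\vec u_s})=1$, let $\mathcal A_k$ be the set of solutions of $f^{\vec u_1}=\dots=f^{\vec u_s}=0$ under precision $\epsilon\|f\|$, and let $\mathcal S_k$ be the set of $P\in\mathcal A_k$ with $|f^{\vec w}(P)|<\epsilon\|f\|$ for all $|\vec w|\le k$ ($\mathcal S_k=\emptyset$ if no such choice exists). $\mathrm{Sing}_\epsilon(\mathcal C)=\bigcup_{k=1}^{d-1}\mathcal S_k$. **Clusters.** Write $P\sim Q$ if $\|P-Q\|_2+|\mathrm{radius}(P)-\mathrm{radius}(Q)|<\mathcal R_{\rm out}(\epsilon)$. For a finite set $\mathcal A$ of $\epsilon$-points, the cluster of $P\in\mathcal A$ is the set of $Q\in\mathcal A$ with $P\sim Q$, or with $P'\sim P$ and $P'\sim Q$ for some $P'\in\mathcal A$. A representative of a cluster is a point of maximum $\epsilon$-multiplicity in it having least $|f|$ among such points; the $\epsilon$-multiplicity of the cluster is that of its representative. $\mathrm{Cluster}_r(R)$ denotes a cluster of $\mathrm{Sing}_\epsilon(\mathcal C)$ with representative $R$ and $\epsilon$-multiplicity $r$. If $\{\mathrm{Cluster}_{r_i}(Q_i)\}_{i=1}^s$ is the cluster decomposition of $\mathrm{Sing}_\epsilon(\mathcal C)$, then $\mathcal C$ is $\epsilon$-rational if $(d-1)(d-2)-\sum_{i=1}^s r_i(r_i-1)=0$. **Approximate Parametrization Algorithm** (for $\epsilon$-rational $\mathcal C$). 1. Compute the cluster decomposition $\{\mathrm{Cluster}_{r_i}(Q_i)\}_{i=1}^s$,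 $Q_i=(q_{i,1}:q_{i,2}:1)$. 2. Determine the linear system of projective plane curves of degree $d-2$ having each $Q_i$ as a base point of multiplicity $r_i-1$. 3. Compute $d-3$ $\epsilon$-ramification points $P_j=(p_{j,1}:p_{j,2}:1)$ of $\mathcal C$, completing with other $\epsilon$-simple points if necessary, real or in complex conjugate pairs, none of them in the cluster of the others or of the $Q_i$. 4. Determine the linear subsystem of the curves that also pass through $P_1,\dots,P_{d-3}$; it may be assumed to have dimension $1$ (if necessary after imposing further $\epsilon$-simple points or slightly perturbing the points). Let $H^*(t,x,y,z)=H_1(x,y,z)+tH_2(x,y,z)$ be its defining polynomial, $H_1,H_2$ homogeneous of degree $d-2$. 5. If $F(x,y,0)$ has a non-trivial common factor with both $H_1(x,y,0)$ and $H_2(x,y,0)$, replace $H_2$ by $H_2+\rho_1x^{d-2}+\rho_2y^{d-2}$ with real $\rho_1,\rho_2$ smaller than $\epsilon$ chosen so that $\gcd(F(x,y,0),H_2(x,y,0))=1$. In all cases, exchanging the roles of $H_1,H_2$ if needed, from here on $\gcd(F(x,y,0),H_2(x,y,0))=1$. 6. Set all $\delta_i=0$. 7. Let $g=\delta_1y^{d-2}+\delta_2y^{d-3}+\delta_3x^{d-2}+\delta_4x^{d-3}+\delta_5x^{d-3}y+\delta_6xy^{d-3}$ if $d>3$, and $g=\delta_1y+\delta_2+\delta_3x$ if $d=3$. 8. Let $S_1(x,t)=\mathrm{Res}_y(H^*(t,x,y,1)+g,f)$, $S_2(y,t)=\mathrm{Res}_x(H^*(t,x,y,1)+g,f)$.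 9. Let $A_1(x)=\prod_{i=1}^s(x-q_{i,1})^{r_i(r_i-1)}\prod_{j=1}^{d-3}(x-p_{j,1})$, $A_2(y)=\prod_{i=1}^s(y-q_{i,2})^{r_i(r_i-1)}\prod_{j=1}^{d-3}(y-p_{j,2})$. 10. Let $B_1(x,t)$ be the quotient of the division of $S_1$ by $A_1$ with respect to $x$, and $B_2(y,t)$ the quotient of $S_2$ by $A_2$ with respect to $y$; $B_1$ is linear in $x$ and $B_2$ is linear in $y$. 11. If the content of $B_1$ with respect to $x$ or the content of $B_2$ with respect to $y$ depends on $t$, choose the $\delta_i$ as small real numbers (smaller than $\epsilon$) and go back to step 7. 12. Return $\overline{\mathcal P}(t)=(\overline p_1(t),\overline p_2(t))$, where $\overline p_1$ is the root of $B_1$ as a polynomial in $x$ and $\overline p_2$ the root of $B_2$ as a polynomial in $y$. *)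

theory Defs
  imports
    "HOL-Analysis.Analysis"
    "HOL-Computational_Algebra.Computational_Algebra"
    "HOL-Computational_Algebra.Field_as_Ring"
    "Subresultants.Resultant_Prelim"
begin

text \<open>
  A polynomial in \<open>\<complex>[x,y]\<close> is an element of \<open>\<complex>[x][y]\<close>: the outer variable is \<open>y\<close>, and the
  coefficient of \<open>x\<^sup>i y\<^sup>j\<close> in \<open>f\<close> is \<open>coeff (coeff f j) i\<close>.  A polynomial in \<open>\<complex>[x,y,z]\<close> is an
  element of \<open>\<complex>[x][y][z]\<close>; hence \<open>poly H 1\<close> is \<open>H(x,y,1)\<close> and \<open>poly H 0\<close> is \<open>H(x,y,0)\<close>.
\<close>

type_synonym poly2 = "complex poly poly"
type_synonym poly3 = "complex poly poly poly"
type_synonym point = "complex \<times> complex"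

definition mono2 :: "complex \<Rightarrow> nat \<Rightarrow> nat \<Rightarrow> poly2" where
  "mono2 c i j = monom (monom c i) j"

definition mono3 :: "complex \<Rightarrow> nat \<Rightarrow> nat \<Rightarrow> nat \<Rightarrow> poly3" where
  "mono3 c i j k = monom (mono2 c i j) k"

definition eval2 :: "poly2 \<Rightarrow> point \<Rightarrow> complex" where
  "eval2 f P = poly (poly f [:snd P:]) (fst P)"

definition eval3 :: "poly3 \<Rightarrow> complex \<Rightarrow> complex \<Rightarrow> complex \<Rightarrow> complex" where
  "eval3 H a b c = eval2 (poly H [:[:c:]:]) (a, b)"

definition total_degree :: "poly2 \<Rightarrow> nat" where
  "total_degree f = Max (insert 0 {i + j | i j. coeff (coeff f j) i \<noteq> 0})"

definition poly_norm :: "poly2 \<Rightarrow> real" where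
  "poly_norm f = Max (range (\<lambda>(i, j). cmod (coeff (coeff f j) i)))"

definition partial :: "nat \<times> nat \<Rightarrow> poly2 \<Rightarrow> poly2" where
  "partial v f = (map_poly pderiv ^^ fst v) ((pderiv ^^ snd v) f)"

definition real_poly :: "poly2 \<Rightarrow> bool" where
  "real_poly f \<longleftrightarrow> (\<forall>i j. coeff (coeff f j) i \<in> \<real>)"

definition homogenization :: "poly2 \<Rightarrow> poly3" where
  "homogenization f =
     (\<Sum>j\<le>degree f. \<Sum>i\<le>degree (coeff f j).
        mono3 (coeff (coeff f j) i) i j (total_degree f - (i + j)))"

definition homogeneous :: "nat \<Rightarrow> poly3 \<Rightarrow> bool" where
  "homogeneous n H \<longleftrightarrow> (\<forall>i j k. coeff (coeff (coeff H k) j) i \<noteq> 0 \<longrightarrow> i + j + k = n)"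

definition singular_point :: "poly3 \<Rightarrow> complex \<Rightarrow> complex \<Rightarrow> complex \<Rightarrow> bool" where
  "singular_point F a b c \<longleftrightarrow>
     eval3 F a b c = 0 \<and>
     eval3 (map_poly (map_poly pderiv) F) a b c = 0 \<and>
     eval3 (map_poly pderiv F) a b c = 0 \<and>
     eval3 (pderiv F) a b c = 0"

definition zero_set :: "poly2 \<Rightarrow> point set" where
  "zero_set f = {P. eval2 f P = 0}"

definition zariski_closure :: "point set \<Rightarrow> point set" where
  "zariski_closure X = {P. \<forall>p. (\<forall>Q\<in>X. eval2 p Q = 0) \<longrightarrow> eval2 p P = 0}"

definition proj_point :: "complex \<Rightarrow> complex \<Rightarrow> complex \<Rightarrow> (complex \<times> complex \<times> complex) set" where
  "proj_point a b c = {(l * a, l * b, l * c) | l. l \<noteq> 0}"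

definition points_at_infinity :: "poly2 \<Rightarrow> (complex \<times> complex \<times> complex) set set" where
  "points_at_infinity f =
     {proj_point a b 0 | a b. (a, b) \<noteq> (0, 0) \<and> eval3 (homogenization f) a b 0 = 0}"

definition proper_degree :: "real \<Rightarrow> poly2 \<Rightarrow> nat \<Rightarrow> bool" where
  "proper_degree \<epsilon> g l \<longleftrightarrow>
     total_degree g = l \<and>
     (\<exists>v. fst v + snd v = l \<and> poly_norm (partial v g) > \<epsilon> * poly_norm g)"

text \<open>
  The perturbation \<open>E\<close> must not raise the degree.  Without this bound no polynomial would be
  \<open>\<epsilon>\<close>-irreducible: \<open>f = (1 + \<eta> x) f - \<eta> x f\<close>, and \<open>\<eta> x f\<close> has norm \<open>\<eta> \<parallel>f\<parallel>\<close>.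
\<close>

definition eps_irreducible :: "real \<Rightarrow> poly2 \<Rightarrow> bool" where
  "eps_irreducible \<epsilon> f \<longleftrightarrow>
     \<not> (\<exists>g h E. f = g * h + E \<and> total_degree g > 0 \<and> total_degree h > 0 \<and>
           total_degree E \<le> total_degree f \<and> poly_norm E < \<epsilon> * poly_norm f)"

definition eps_point :: "real \<Rightarrow> poly2 \<Rightarrow> point \<Rightarrow> bool" where
  "eps_point \<epsilon> f P \<longleftrightarrow> cmod (eval2 f P) < \<epsilon> * poly_norm f"

definition eps_mult :: "real \<Rightarrow> poly2 \<Rightarrow> point \<Rightarrow> nat" where
  "eps_mult \<epsilon> f P =
     (LEAST r. (\<forall>v. fst v + snd v < r \<longrightarrow> cmod (eval2 (partial v f) P) < \<epsilon> * poly_norm f) \<and>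
               (\<exists>v. fst v + snd v = r \<and> cmod (eval2 (partial v f) P) \<ge> \<epsilon> * poly_norm f))"

definition eps_simple :: "real \<Rightarrow> poly2 \<Rightarrow> point \<Rightarrow> bool" where
  "eps_simple \<epsilon> f P \<longleftrightarrow> eps_point \<epsilon> f P \<and> eps_mult \<epsilon> f P = 1"

definition eps_ramification :: "real \<Rightarrow> poly2 \<Rightarrow> point \<Rightarrow> bool" where
  "eps_ramification \<epsilon> f P \<longleftrightarrow>
     eps_simple \<epsilon> f P \<and>
     (cmod (eval2 (partial (1, 0) f) P) < \<epsilon> * poly_norm f \<or>
      cmod (eval2 (partial (0, 1) f) P) < \<epsilon> * poly_norm f)"

definition axis_index :: "nat \<Rightarrow> nat \<Rightarrow> nat \<times> nat" where
  "axis_index k i = (if k = 1 then (i, 0) else (0, i))"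

definition pure_in :: "real \<Rightarrow> poly2 \<Rightarrow> point \<Rightarrow> nat \<Rightarrow> bool" where
  "pure_in \<epsilon> f P k \<longleftrightarrow>
     k \<in> {1, 2} \<and> eps_mult \<epsilon> f P > 1 \<and>
     cmod (eval2 (partial (axis_index k (eps_mult \<epsilon> f P)) f) P) \<ge> \<epsilon> * poly_norm f"

definition weight_in :: "real \<Rightarrow> poly2 \<Rightarrow> point \<Rightarrow> nat \<Rightarrow> real" where
  "weight_in \<epsilon> f P k =
     (let r = eps_mult \<epsilon> f P in
      Max ((\<lambda>i. root (r - i)
              (cmod ((fact r * eval2 (partial (axis_index k i) f) P) /
                     (fact i * eval2 (partial (axis_index k r) f) P)))) ` {0..r-1}))"

definition weight :: "real \<Rightarrow> poly2 \<Rightarrow> point \<Rightarrow> real" where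
  "weight \<epsilon> f P = Max (weight_in \<epsilon> f P ` {k. pure_in \<epsilon> f P k})"

definition R_out :: "real \<Rightarrow> real" where
  "R_out x = 1/2 - x * (1 - 9 * x) / (2 * (1 + 3 * x)) - 32 * x^2 / (1 + 3 * x)^3"

definition radius :: "real \<Rightarrow> poly2 \<Rightarrow> point \<Rightarrow> real" where
  "radius \<epsilon> f P = (if \<exists>k. pure_in \<epsilon> f P k then R_out (weight \<epsilon> f P) else 0)"

text \<open>
  A solution set computed under fixed precision \<open>\<tau>\<close> is a finite set of points at which every
  equation holds up to \<open>\<tau>\<close> and which approximates every exact solution up to \<open>\<tau>\<close>.  It is not
  determined by the system, so it is a relation.
\<close>

definition solutions_under_precision :: "real \<Rightarrow> poly2 set \<Rightarrow> point set \<Rightarrow> bool" where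
  "solutions_under_precision \<tau> G A \<longleftrightarrow>
     finite A \<and>
     (\<forall>P\<in>A. \<forall>p\<in>G. cmod (eval2 p P) < \<tau>) \<and>
     (\<forall>Q. (\<forall>p\<in>G. eval2 p Q = 0) \<longrightarrow> (\<exists>P\<in>A. norm (P - Q) < \<tau>))"

definition admissible_derivatives :: "poly2 \<Rightarrow> nat \<Rightarrow> (nat \<times> nat) set \<Rightarrow> bool" where
  "admissible_derivatives f k U \<longleftrightarrow>
     (\<forall>u\<in>U. fst u + snd u = k) \<and> 2 \<le> card U \<and> card U \<le> k + 1 \<and>
     Gcd_fin ((\<lambda>u. partial u f) ` U) = 1"

definition eps_singular_locus :: "real \<Rightarrow> poly2 \<Rightarrow> point set \<Rightarrow> bool" where
  "eps_singular_locus \<epsilon> f S \<longleftrightarrow>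
     (let d = total_degree f; \<tau> = \<epsilon> * poly_norm f in
      \<exists>SS :: nat \<Rightarrow> point set.
        S = (\<Union>k\<in>{1..d-1}. SS k) \<and>
        solutions_under_precision \<tau> {f, partial (1, 0) f, partial (0, 1) f} (SS 1) \<and>
        (\<forall>k\<in>{2..d-1}.
           if \<exists>U. admissible_derivatives f k U
           then \<exists>U A. admissible_derivatives f k U \<and>
                  solutions_under_precision \<tau> ((\<lambda>u. partial u f) ` U) A \<and>
                  SS k = {P \<in> A. \<forall>w. fst w + snd w \<le> k \<longrightarrow> cmod (eval2 (partial w f) P) < \<tau>}
           else SS k = {}))"

definition close :: "real \<Rightarrow> poly2 \<Rightarrow> point \<Rightarrow> point \<Rightarrow> bool" where
  "close \<epsilon> f P Q \<longleftrightarrow> norm (P - Q) + \<bar>radius \<epsilon> f P - radius \<epsilon> f Q\<bar> < R_out \<epsilon>"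

definition cluster :: "real \<Rightarrow> poly2 \<Rightarrow> point set \<Rightarrow> point \<Rightarrow> point set" where
  "cluster \<epsilon> f A P =
     {Q \<in> A. close \<epsilon> f P Q \<or> (\<exists>P'\<in>A. close \<epsilon> f P' P \<and> close \<epsilon> f P' Q)}"

definition clusters :: "real \<Rightarrow> poly2 \<Rightarrow> point set \<Rightarrow> point set set" where
  "clusters \<epsilon> f A = cluster \<epsilon> f A ` A"

definition representative :: "real \<Rightarrow> poly2 \<Rightarrow> point set \<Rightarrow> point \<Rightarrow> bool" where
  "representative \<epsilon> f K R \<longleftrightarrow>
     R \<in> K \<and>
     (\<forall>P\<in>K. eps_mult \<epsilon> f P \<le> eps_mult \<epsilon> f R) \<and>
     (\<forall>P\<in>K. eps_mult \<epsilon> f P = eps_mult \<epsilon> f R \<longrightarrow> cmod (eval2 f R) \<le> cmod (eval2 f P))"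

text \<open>
  A cluster decomposition is given by a choice \<open>rep\<close> of a representative for each cluster; sums and
  products over the decomposition are indexed by the clusters themselves.
\<close>

definition cluster_decomposition ::
  "real \<Rightarrow> poly2 \<Rightarrow> point set \<Rightarrow> (point set \<Rightarrow> point) \<Rightarrow> bool" where
  "cluster_decomposition \<epsilon> f S rep \<longleftrightarrow> (\<forall>K\<in>clusters \<epsilon> f S. representative \<epsilon> f K (rep K))"

definition eps_rational :: "real \<Rightarrow> poly2 \<Rightarrow> point set \<Rightarrow> bool" where
  "eps_rational \<epsilon> f S \<longleftrightarrow>
     (\<forall>rep. cluster_decomposition \<epsilon> f S rep \<longrightarrow>
        (int (total_degree f) - 1) * (int (total_degree f) - 2)
        - (\<Sum>K\<in>clusters \<epsilon> f S.
             int (eps_mult \<epsilon> f (rep K)) * (int (eps_mult \<epsilon> f (rep K)) - 1)) = 0)"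

text \<open>The curve \<open>H = 0\<close> has multiplicity at least \<open>m\<close> at \<open>(q\<^sub>1 : q\<^sub>2 : 1)\<close>.\<close>

definition multiplicity_ge :: "poly3 \<Rightarrow> point \<Rightarrow> nat \<Rightarrow> bool" where
  "multiplicity_ge H q m \<longleftrightarrow> (\<forall>v. fst v + snd v < m \<longrightarrow> eval2 (partial v (poly H 1)) q = 0)"

definition adjoint_system ::
  "real \<Rightarrow> poly2 \<Rightarrow> point set \<Rightarrow> (point set \<Rightarrow> point) \<Rightarrow> poly3 set" where
  "adjoint_system \<epsilon> f S rep =
     {H. homogeneous (total_degree f - 2) H \<and>
         (\<forall>K\<in>clusters \<epsilon> f S. multiplicity_ge H (rep K) (eps_mult \<epsilon> f (rep K) - 1))}"

definition through :: "poly3 set \<Rightarrow> point set \<Rightarrow> poly3 set" where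
  "through L X = {H \<in> L. \<forall>(a, b)\<in>X. eval3 H a b 1 = 0}"

text \<open>\<open>L\<close> is a linear system of (projective) dimension 1 with basis \<open>H\<^sub>1, H\<^sub>2\<close>.\<close>

definition pencil :: "poly3 set \<Rightarrow> poly3 \<Rightarrow> poly3 \<Rightarrow> bool" where
  "pencil L H1 H2 \<longleftrightarrow>
     L = {Polynomial.smult [:[:a:]:] H1 + Polynomial.smult [:[:b:]:] H2 | a b. True} \<and>
     (\<forall>a b. Polynomial.smult [:[:a:]:] H1 + Polynomial.smult [:[:b:]:] H2 = 0 \<longrightarrow> a = 0 \<and> b = 0)"

definition admissible_points ::
  "real \<Rightarrow> poly2 \<Rightarrow> point set \<Rightarrow> (point set \<Rightarrow> point) \<Rightarrow> point list \<Rightarrow> bool" where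
  "admissible_points \<epsilon> f S rep Ps \<longleftrightarrow>
     length Ps = total_degree f - 3 \<and> distinct Ps \<and>
     (\<forall>P\<in>set Ps. eps_simple \<epsilon> f P \<and> (cnj (fst P), cnj (snd P)) \<in> set Ps) \<and>
     (\<forall>P\<in>set Ps. \<forall>X\<in>(set Ps - {P}) \<union> rep ` clusters \<epsilon> f S.
        P \<notin> cluster \<epsilon> f (S \<union> set Ps) X)"

text \<open>
  Ramification points are used as far as possible; other simple points only fill up the list.
\<close>

definition simple_points ::
  "real \<Rightarrow> poly2 \<Rightarrow> point set \<Rightarrow> (point set \<Rightarrow> point) \<Rightarrow> point list \<Rightarrow> bool" where
  "simple_points \<epsilon> f S rep Ps \<longleftrightarrow>
     admissible_points \<epsilon> f S rep Ps \<and>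
     (\<forall>Ps'. admissible_points \<epsilon> f S rep Ps' \<longrightarrow>
        card {P \<in> set Ps'. eps_ramification \<epsilon> f P} \<le> card {P \<in> set Ps. eps_ramification \<epsilon> f P})"

text \<open>
  \<open>Ps'\<close> is the list \<open>Ps\<close> itself or, only if the system through \<open>Ps\<close> is not a pencil, a perturbation
  of it, possibly with further simple points \<open>E\<close> imposed.
\<close>

definition base_pencil ::
  "real \<Rightarrow> poly2 \<Rightarrow> point set \<Rightarrow> (point set \<Rightarrow> point) \<Rightarrow> point list \<Rightarrow> point list
     \<Rightarrow> poly3 \<Rightarrow> poly3 \<Rightarrow> bool" where
  "base_pencil \<epsilon> f S rep Ps Ps' H1 H2 \<longleftrightarrow>
     (let L = adjoint_system \<epsilon> f S rep in
      (Ps' = Ps \<and> pencil (through L (set Ps)) H1 H2) \<or>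
      ((\<nexists>G1 G2. pencil (through L (set Ps)) G1 G2) \<and>
       list_all2 (\<lambda>P P'. norm (P' - P) < \<epsilon>) Ps Ps' \<and>
       (\<exists>E. finite E \<and> (\<forall>P\<in>E. eps_simple \<epsilon> f P) \<and>
            pencil (through L (set Ps' \<union> E)) H1 H2)))"

definition normalized_pencil ::
  "real \<Rightarrow> poly2 \<Rightarrow> poly3 \<Rightarrow> poly3 \<Rightarrow> poly3 \<Rightarrow> poly3 \<Rightarrow> bool" where
  "normalized_pencil \<epsilon> f G1 G2 H1 H2 \<longleftrightarrow>
     (let d = total_degree f; F0 = poly (homogenization f) 0 in
      (if \<not> coprime F0 (poly G1 0) \<and> \<not> coprime F0 (poly G2 0)
       then H1 = G1 \<and>
            (\<exists>\<rho>1 \<rho>2 :: real. \<bar>\<rho>1\<bar> < \<epsilon> \<and> \<bar>\<rho>2\<bar> < \<epsilon> \<and>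
               H2 = G2 + mono3 (of_real \<rho>1) (d - 2) 0 0 + mono3 (of_real \<rho>2) 0 (d - 2) 0)
       else (H1, H2) \<in> {(G1, G2), (G2, G1)}) \<and>
      coprime F0 (poly H2 0))"

definition perturbation :: "nat \<Rightarrow> (nat \<Rightarrow> real) \<Rightarrow> poly2" where
  "perturbation d \<delta> =
     (if d > 3 then
        mono2 (of_real (\<delta> 1)) 0 (d - 2) + mono2 (of_real (\<delta> 2)) 0 (d - 3)
        + mono2 (of_real (\<delta> 3)) (d - 2) 0 + mono2 (of_real (\<delta> 4)) (d - 3) 0
        + mono2 (of_real (\<delta> 5)) (d - 3) 1 + mono2 (of_real (\<delta> 6)) 1 (d - 3)
      else
        mono2 (of_real (\<delta> 1)) 0 1 + mono2 (of_real (\<delta> 2)) 0 0 + mono2 (of_real (\<delta> 3)) 1 0)"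

definition swap_vars :: "poly2 \<Rightarrow> poly2" where
  "swap_vars f = (\<Sum>j\<le>degree f. \<Sum>i\<le>degree (coeff f j). mono2 (coeff (coeff f j) i) j i)"

text \<open>The embedding of \<open>\<complex>[x][y]\<close> into \<open>\<complex>[t][x][y]\<close>.\<close>

definition lift_t :: "poly2 \<Rightarrow> complex poly poly poly" where
  "lift_t f = map_poly (map_poly (\<lambda>c. [:c:])) f"

text \<open>
  \<open>Res\<^sub>y(h\<^sub>1 + t h\<^sub>2, f)\<close> as an element of \<open>\<complex>[t][x]\<close>; swapping the variables of the arguments turns it
  into the resultant with respect to \<open>x\<close>, an element of \<open>\<complex>[t][y]\<close>.
\<close>

definition pencil_resultant :: "poly2 \<Rightarrow> poly2 \<Rightarrow> poly2 \<Rightarrow> complex poly poly" where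
  "pencil_resultant h1 h2 f = resultant (lift_t h1 + Polynomial.smult [:[:0, 1:]:] (lift_t h2)) (lift_t f)"

text \<open>\<open>pr\<close> is the coordinate function, and the product lies in \<open>\<complex>[t][x]\<close> (resp. \<open>\<complex>[t][y]\<close>).\<close>

definition known_factor ::
  "real \<Rightarrow> poly2 \<Rightarrow> point set \<Rightarrow> (point set \<Rightarrow> point) \<Rightarrow> point list \<Rightarrow> (point \<Rightarrow> complex)
     \<Rightarrow> complex poly poly" where
  "known_factor \<epsilon> f S rep Ps pr =
     (\<Prod>K\<in>clusters \<epsilon> f S.
        [:- [:pr (rep K):], 1:] ^ (eps_mult \<epsilon> f (rep K) * (eps_mult \<epsilon> f (rep K) - 1)))
     * (\<Prod>P\<leftarrow>Ps. [:- [:pr P:], 1:])"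

definition is_quotient :: "'a::comm_ring_1 poly \<Rightarrow> 'a poly \<Rightarrow> 'a poly \<Rightarrow> bool" where
  "is_quotient S A B \<longleftrightarrow> (\<exists>R. S = A * B + R \<and> (R = 0 \<or> degree R < degree A))"

definition quotients ::
  "real \<Rightarrow> poly2 \<Rightarrow> point set \<Rightarrow> (point set \<Rightarrow> point) \<Rightarrow> point list \<Rightarrow> poly3 \<Rightarrow> poly3
     \<Rightarrow> (nat \<Rightarrow> real) \<Rightarrow> complex poly poly \<Rightarrow> complex poly poly \<Rightarrow> bool" where
  "quotients \<epsilon> f S rep Ps H1 H2 \<delta> B1 B2 \<longleftrightarrow>
     (let h1 = poly H1 1 + perturbation (total_degree f) \<delta>; h2 = poly H2 1 in
      is_quotient (pencil_resultant h1 h2 f) (known_factor \<epsilon> f S rep Ps fst) B1 \<and>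
      is_quotient (pencil_resultant (swap_vars h1) (swap_vars h2) (swap_vars f))
        (known_factor \<epsilon> f S rep Ps snd) B2)"

definition contents_constant :: "complex poly poly \<Rightarrow> complex poly poly \<Rightarrow> bool" where
  "contents_constant B1 B2 \<longleftrightarrow> degree (content B1) = 0 \<and> degree (content B2) = 0"

text \<open>
  The relation between the input and the possible outputs \<open>(p\<^sub>1, p\<^sub>2) \<in> \<complex>(t)\<^sup>2\<close> of the algorithm, for the
  computed singular locus \<open>S\<close>.  The loop is left with \<open>\<delta> = 0\<close>, unless a content depends on \<open>t\<close>.
\<close>

definition approximate_parametrization ::
  "real \<Rightarrow> poly2 \<Rightarrow> point set \<Rightarrow> complex poly fract \<Rightarrow> complex poly fract \<Rightarrow> bool" where
  "approximate_parametrization \<epsilon> f S p1 p2 \<longleftrightarrow>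
     (\<exists>rep Ps Ps' G1 G2 H1 H2 \<delta> B1 B2.
        cluster_decomposition \<epsilon> f S rep \<and>
        simple_points \<epsilon> f S rep Ps \<and>
        base_pencil \<epsilon> f S rep Ps Ps' G1 G2 \<and>
        normalized_pencil \<epsilon> f G1 G2 H1 H2 \<and>
        (\<delta> = (\<lambda>_. 0) \<or>
         (\<forall>i. \<bar>\<delta> i\<bar> < \<epsilon>) \<and>
         (\<exists>C1 C2. quotients \<epsilon> f S rep Ps' H1 H2 (\<lambda>_. 0) C1 C2 \<and> \<not> contents_constant C1 C2)) \<and>
        quotients \<epsilon> f S rep Ps' H1 H2 \<delta> B1 B2 \<and>
        contents_constant B1 B2 \<and>
        poly (map_poly to_fract B1) p1 = 0 \<and>
        poly (map_poly to_fract B2) p2 = 0)"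

definition parametrized_curve :: "complex poly fract \<Rightarrow> complex poly fract \<Rightarrow> point set" where
  "parametrized_curve p1 p2 =
     zariski_closure
       {(poly (fst (quot_of_fract p1)) t / poly (snd (quot_of_fract p1)) t,
         poly (fst (quot_of_fract p2)) t / poly (snd (quot_of_fract p2)) t) | t.
        poly (snd (quot_of_fract p1)) t \<noteq> 0 \<and> poly (snd (quot_of_fract p2)) t \<noteq> 0}"

definition defining_polynomial :: "poly2 \<Rightarrow> point set \<Rightarrow> bool" where
  "defining_polynomial q C \<longleftrightarrow> irreducible q \<and> zero_set q = C"

end

theory Submission
  imports Defs "Subresultants.Subresultant_Gcd"
begin

text \<open>
  Write \<open>m = d - 2\<close>, \<open>D = m d\<close>, and let \<open>h\<^sub>1 + t h\<^sub>2\<close> be the pencil whose resultants with \<open>f\<close> are taken.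
  The resultant with respect to \<open>y\<close> has degree at most \<open>D\<close> in \<open>x\<close>, and the known factor is monic of
  degree \<open>D - 1\<close>, because \<open>f\<close> is \<open>\<epsilon>\<close>-rational, with coefficients free of \<open>t\<close>.  The quotient is
  therefore read off the two highest coefficients of the resultant, up to a nonzero constant:
  if these are \<open>b(t)\<close> and \<open>N\<^sub>x(t)\<close>, then \<open>p\<^sub>1 = (a b - N\<^sub>x) / b\<close> for a constant \<open>a\<close>, whether or not the
  division leaves a remainder.  In the same way \<open>p\<^sub>2 = (a' b - N\<^sub>y) / b\<close>, with the same \<open>b\<close>: both
  leading coefficients are the resultant of the top forms of \<open>h\<^sub>1 + t h\<^sub>2\<close> and \<open>f\<close>.

  Since the top forms of \<open>f\<close> and \<open>h\<^sub>2\<close> have no common zero, \<open>b\<close> has degree exactly \<open>d\<close>, its zeros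
  are the \<open>t\<close> at which the top forms of \<open>h\<^sub>1 + t h\<^sub>2\<close> and \<open>f\<close> have a common zero \<open>(1 : \<beta>)\<close>, and every
  zero of the top form of \<open>f\<close> is met by some \<open>t\<close>.  The heart of the proof is that
  \<open>N\<^sub>y(t) = \<beta> N\<^sub>x(t)\<close> at such a \<open>t\<close> (\<open>sylvester_variation_direction\<close>).  Let \<open>P, Q\<close> be the top forms at
  \<open>x = 1\<close> and \<open>U, V\<close> the forms of the next lower degree.  Expanding the Sylvester determinant by
  weights (\<open>resultant_sub_top_coeffs\<close>) shows that \<open>N\<^sub>x\<close> is the first variation of the determinant
  for \<open>(P, Q)\<close> in the direction \<open>(U, V)\<close>, and \<open>N\<^sub>y\<close> is the one in the direction \<open>(y U, y V)\<close>.  The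
  variation is linear in the direction, and it vanishes in the direction
  \<open>((y - \<beta>) U, (y - \<beta>) V)\<close>, because all polynomials involved then vanish at \<open>\<beta>\<close>, so that the perturbed
  matrix still kills the vector of powers of \<open>\<beta>\<close>.

  The contents being constant, the numerators \<open>n\<^sub>1 = a b - N\<^sub>x\<close> and \<open>n\<^sub>2 = a' b - N\<^sub>y\<close> have no zero
  in common with \<open>b\<close>.  So \<open>(n\<^sub>1 : n\<^sub>2 : b)\<close> maps the zeros of \<open>b\<close> onto the points at infinity of \<open>f\<close>, and
  it remains to see that these are the points at infinity of the parametrized curve, and that a
  curve parametrized by polynomials of degree at most \<open>d\<close> has degree at most \<open>d\<close>
  (locale \<open>rational_curve\<close>).  Given a direction \<open>(\<alpha> : \<beta>)\<close> not of the form \<open>(n\<^sub>1(t) : n\<^sub>2(t))\<close> with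
  \<open>b(t) = 0\<close>, a characteristic polynomial yields a polynomial of total degree \<open>d\<close> that vanishes
  on the curve and whose top form does not vanish at \<open>(\<alpha>, \<beta>)\<close> (\<open>vanishing_polynomial\<close>).  The
  irreducible equation of the curve divides it (\<open>vanishing_divisible\<close>), hence has degree at
  most \<open>d\<close> and a top form that does not vanish at \<open>(\<alpha>, \<beta>)\<close> either.
\<close>

section \<open>Weighted determinants and the first variation of a determinant\<close>

text \<open>
  Here \<open>m\<close> and \<open>n\<close> are only bounds for the degrees, as they will come from weights.  Prepending a
  zero coefficient makes \<open>coeff (pCons 0 p) m\<close> denote the coefficient of index \<open>m - 1\<close>, read as \<open>0\<close>
  for \<open>m = 0\<close>; the second claim is the product rule for the two highest coefficients.
\<close>

lemma coeff_mult_at_bounds: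
  fixes p q :: "'a :: comm_ring_1 poly"
  assumes "degree p \<le> m" "degree q \<le> n"
  shows "coeff (p * q) (m + n) = coeff p m * coeff q n"
    and "coeff (pCons 0 (p * q)) (m + n) =
           coeff (pCons 0 p) m * coeff q n + coeff p m * coeff (pCons 0 q) n"
proof -
  have pz: "coeff p i = 0" if "i > m" for i using that assms(1) by (simp add: coeff_eq_0)
  have qz: "coeff q i = 0" if "i > n" for i using that assms(2) by (simp add: coeff_eq_0)
  have "coeff (p * q) (m + n) = (\<Sum>i\<in>{m}. coeff p i * coeff q (m + n - i))"
    unfolding coeff_mult
  proof (rule sum.mono_neutral_right)
    show "\<forall>i\<in>{..m + n} - {m}. coeff p i * coeff q (m + n - i) = 0"
    proof
      fix i assume "i \<in> {..m + n} - {m}"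
      then have "i > m \<or> m + n - i > n" by auto
      then show "coeff p i * coeff q (m + n - i) = 0" using pz qz by auto
    qed
  qed auto
  then show "coeff (p * q) (m + n) = coeff p m * coeff q n" by simp
  show "coeff (pCons 0 (p * q)) (m + n) =
           coeff (pCons 0 p) m * coeff q n + coeff p m * coeff (pCons 0 q) n"
  proof (cases m)
    case 0
    then have "p = [:coeff p 0:]" using assms(1) by (metis degree_0_id le_zero_eq)
    then obtain c where "p = [:c:]" by blast
    then show ?thesis using 0 by (cases n) auto
  next
    case (Suc m')
    show ?thesis
    proof (cases n)
      case 0
      then have "q = [:coeff q 0:]" using assms(2) by (metis degree_0_id le_zero_eq)
      then obtain c where "q = [:c:]" by blast
      then show ?thesis using 0 by (cases m) (auto simp: mult.commute)
    next
      case (Suc n')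
      note m = \<open>m = Suc m'\<close> and n = Suc
      have "coeff (p * q) (Suc (m' + n')) = (\<Sum>i\<in>{m', Suc m'}. coeff p i * coeff q (Suc (m' + n') - i))"
        unfolding coeff_mult
      proof (rule sum.mono_neutral_right)
        show "\<forall>i\<in>{..Suc (m' + n')} - {m', Suc m'}. coeff p i * coeff q (Suc (m' + n') - i) = 0"
        proof
          fix i assume "i \<in> {..Suc (m' + n')} - {m', Suc m'}"
          then have "i > m \<or> Suc (m' + n') - i > n" using m n by auto
          then show "coeff p i * coeff q (Suc (m' + n') - i) = 0" using pz qz by auto
        qed
      qed auto
      then show ?thesis using m n by (simp add: Suc_diff_le)
    qed
  qed
qed

lemma prod_coeffs_at_bounds:
  fixes f :: "'i \<Rightarrow> 'a :: comm_ring_1 poly"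
  assumes "finite I" "\<And>i. i \<in> I \<Longrightarrow> degree (f i) \<le> e i"
  shows "degree (\<Prod>i\<in>I. f i) \<le> (\<Sum>i\<in>I. e i)"
    and "coeff (\<Prod>i\<in>I. f i) (\<Sum>i\<in>I. e i) = (\<Prod>i\<in>I. coeff (f i) (e i))"
    and "coeff (pCons 0 (\<Prod>i\<in>I. f i)) (\<Sum>i\<in>I. e i) =
           (\<Sum>i\<in>I. coeff (pCons 0 (f i)) (e i) * (\<Prod>k\<in>I - {i}. coeff (f k) (e k)))"
proof -
  have "degree (\<Prod>i\<in>I. f i) \<le> (\<Sum>i\<in>I. e i) \<and>
    coeff (\<Prod>i\<in>I. f i) (\<Sum>i\<in>I. e i) = (\<Prod>i\<in>I. coeff (f i) (e i)) \<and>
    coeff (pCons 0 (\<Prod>i\<in>I. f i)) (\<Sum>i\<in>I. e i) =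
           (\<Sum>i\<in>I. coeff (pCons 0 (f i)) (e i) * (\<Prod>k\<in>I - {i}. coeff (f k) (e k)))"
    using assms
  proof (induction I rule: finite_induct)
    case empty
    then show ?case by simp
  next
    case (insert a I)
    let ?F = "\<Prod>i\<in>I. f i" and ?E = "\<Sum>i\<in>I. e i"
    have IH: "degree ?F \<le> ?E" "coeff ?F ?E = (\<Prod>i\<in>I. coeff (f i) (e i))"
      "coeff (pCons 0 ?F) ?E = (\<Sum>i\<in>I. coeff (pCons 0 (f i)) (e i) * (\<Prod>k\<in>I - {i}. coeff (f k) (e k)))"
      using insert by auto
    have a: "degree (f a) \<le> e a" using insert by auto
    have 1: "degree (f a * ?F) \<le> e a + ?E"
      using degree_mult_le[of "f a" ?F] a IH(1) by linarith
    have 2: "(\<Prod>k\<in>insert a I - {i}. coeff (f k) (e k)) = coeff (f a) (e a) * (\<Prod>k\<in>I - {i}. coeff (f k) (e k))"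
      if "i \<in> I" for i
    proof -
      have "insert a I - {i} = insert a (I - {i})" using that insert.hyps by auto
      then show ?thesis using insert.hyps by simp
    qed
    have 3: "insert a I - {a} = I" using insert.hyps by auto
    show ?case
      using insert.hyps 1 coeff_mult_at_bounds[OF a IH(1)] IH(2,3)
      by (simp add: 2 3 sum_distrib_left mult.left_commute)
  qed
  then show "degree (\<Prod>i\<in>I. f i) \<le> (\<Sum>i\<in>I. e i)"
    and "coeff (\<Prod>i\<in>I. f i) (\<Sum>i\<in>I. e i) = (\<Prod>i\<in>I. coeff (f i) (e i))"
    and "coeff (pCons 0 (\<Prod>i\<in>I. f i)) (\<Sum>i\<in>I. e i) =
           (\<Sum>i\<in>I. coeff (pCons 0 (f i)) (e i) * (\<Prod>k\<in>I - {i}. coeff (f k) (e k)))"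
    by blast+
qed

text \<open>
  The coefficient of \<open>\<eta>\<close> in the determinant of \<open>A + \<eta> B\<close>, that is, the derivative of the
  determinant at \<open>A\<close> in the direction \<open>B\<close>.
\<close>

definition det_variation :: "nat \<Rightarrow> (nat \<Rightarrow> nat \<Rightarrow> 'a) \<Rightarrow> (nat \<Rightarrow> nat \<Rightarrow> 'a) \<Rightarrow> 'a :: comm_ring_1" where
  "det_variation N A B =
     (\<Sum>\<sigma> | \<sigma> permutes {0..<N}. signof \<sigma> *
        (\<Sum>i\<in>{0..<N}. B i (\<sigma> i) * (\<Prod>k\<in>{0..<N} - {i}. A k (\<sigma> k))))"

lemma coeff_signof_mult: "coeff (signof \<sigma> * p) k = signof \<sigma> * coeff (p :: 'a :: comm_ring_1 poly) k"
  by (cases "sign \<sigma> = 1") (auto simp: sign_def)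

text \<open>
  If the degrees of the entries are bounded in such a way that all permutations contribute terms of
  the same total weight \<open>W\<close>, then the coefficients of index \<open>W\<close> and \<open>W - 1\<close> of the determinant depend
  only on the coefficients of the entries at the bound and just below it: the first one is the
  determinant of the matrix of coefficients at the bound, and the second one is the variation at this
  matrix in the direction of the coefficients below it.  The condition on the weight is restricted to
  permutations that avoid zero entries, because the zeros of a band matrix have no sensible weight.
\<close>

lemma det_weighted:
  fixes A :: "'a :: comm_ring_1 poly mat"
  assumes A: "A \<in> carrier_mat N N"
    and deg: "\<forall>i<N. \<forall>j<N. degree (A $$ (i, j)) \<le> e i j"
    and weight: "\<forall>\<sigma>. \<sigma> permutes {0..<N} \<longrightarrow> (\<forall>i<N. A $$ (i, \<sigma> i) \<noteq> 0) \<longrightarrow>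
                   (\<Sum>i\<in>{0..<N}. e i (\<sigma> i)) = W"
  shows "degree (det A) \<le> W"
    and "coeff (det A) W = det (mat N N (\<lambda>(i, j). coeff (A $$ (i, j)) (e i j)))"
    and "coeff (pCons 0 (det A)) W =
           det_variation N (\<lambda>i j. coeff (A $$ (i, j)) (e i j)) (\<lambda>i j. coeff (pCons 0 (A $$ (i, j))) (e i j))"
proof -
  let ?P = "{\<sigma>. \<sigma> permutes {0..<N}}"
  have fin: "finite ?P" by (simp add: finite_permutations)
  have det: "det A = (\<Sum>\<sigma>\<in>?P. signof \<sigma> * (\<Prod>i = 0..<N. A $$ (i, \<sigma> i)))" by (rule det_def'[OF A])
  have main: "degree (\<Prod>i = 0..<N. A $$ (i, \<sigma> i)) \<le> W \<and>
    coeff (\<Prod>i = 0..<N. A $$ (i, \<sigma> i)) W = (\<Prod>i = 0..<N. coeff (A $$ (i, \<sigma> i)) (e i (\<sigma> i))) \<and>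
    coeff (pCons 0 (\<Prod>i = 0..<N. A $$ (i, \<sigma> i))) W =
      (\<Sum>i\<in>{0..<N}. coeff (pCons 0 (A $$ (i, \<sigma> i))) (e i (\<sigma> i)) *
           (\<Prod>k\<in>{0..<N} - {i}. coeff (A $$ (k, \<sigma> k)) (e k (\<sigma> k))))"
    if \<sigma>: "\<sigma> \<in> ?P" for \<sigma>
  proof (cases "\<forall>i<N. A $$ (i, \<sigma> i) \<noteq> 0")
    case True
    then have W: "(\<Sum>i\<in>{0..<N}. e i (\<sigma> i)) = W" using weight \<sigma> by auto
    have "degree (A $$ (i, \<sigma> i)) \<le> e i (\<sigma> i)" if "i \<in> {0..<N}" for i
      using deg that \<sigma> permutes_in_image[of \<sigma> "{0..<N}" i] by auto
    from prod_coeffs_at_bounds[of "{0..<N}" "\<lambda>i. A $$ (i, \<sigma> i)" "\<lambda>i. e i (\<sigma> i)", OF _ this, unfolded W]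
    show ?thesis by simp
  next
    case False
    then obtain i0 where i0: "i0 < N" "A $$ (i0, \<sigma> i0) = 0" by auto
    have 0: "(\<Prod>i = 0..<N. A $$ (i, \<sigma> i)) = 0" by (rule prod_zero) (use i0 in auto)
    have 1: "(\<Prod>i = 0..<N. coeff (A $$ (i, \<sigma> i)) (e i (\<sigma> i))) = 0"
      by (rule prod_zero) (use i0 in \<open>auto intro!: bexI[of _ i0]\<close>)
    have 2: "coeff (pCons 0 (A $$ (i, \<sigma> i))) (e i (\<sigma> i)) *
           (\<Prod>k\<in>{0..<N} - {i}. coeff (A $$ (k, \<sigma> k)) (e k (\<sigma> k))) = 0" if "i \<in> {0..<N}" for i
    proof (cases "i = i0")
      case False
      have "(\<Prod>k\<in>{0..<N} - {i}. coeff (A $$ (k, \<sigma> k)) (e k (\<sigma> k))) = 0"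
        by (rule prod_zero) (use i0 False in \<open>auto intro!: bexI[of _ i0]\<close>)
      then show ?thesis by simp
    qed (use i0 in \<open>simp\<close>)
    show ?thesis unfolding 0 1 by (simp add: 2)
  qed
  have sdeg: "degree (signof \<sigma> * p) = degree p" for \<sigma> and p :: "'a poly"
    by (cases "sign \<sigma> = 1") (auto simp: sign_def)
  show "degree (det A) \<le> W" unfolding det
    by (rule degree_sum_le[OF fin]) (use main sdeg in auto)
  show "coeff (det A) W = det (mat N N (\<lambda>(i, j). coeff (A $$ (i, j)) (e i j)))"
  proof -
    have "det (mat N N (\<lambda>(i, j). coeff (A $$ (i, j)) (e i j))) =
      (\<Sum>\<sigma>\<in>?P. signof \<sigma> * (\<Prod>i = 0..<N. mat N N (\<lambda>(i, j). coeff (A $$ (i, j)) (e i j)) $$ (i, \<sigma> i)))"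
      by (rule det_def') simp
    also have "\<dots> = (\<Sum>\<sigma>\<in>?P. signof \<sigma> * (\<Prod>i = 0..<N. coeff (A $$ (i, \<sigma> i)) (e i (\<sigma> i))))"
      by (intro sum.cong refl arg_cong2[of _ _ _ _ "(*)"] prod.cong)
        (auto simp: permutes_in_image)
    also have "\<dots> = coeff (det A) W"
      unfolding det coeff_sum coeff_signof_mult by (intro sum.cong) (use main in auto)
    finally show ?thesis by simp
  qed
  show "coeff (pCons 0 (det A)) W =
           det_variation N (\<lambda>i j. coeff (A $$ (i, j)) (e i j)) (\<lambda>i j. coeff (pCons 0 (A $$ (i, j))) (e i j))"
  proof -
    have "coeff (pCons 0 (det A)) W =
       (\<Sum>\<sigma>\<in>?P. signof \<sigma> * coeff (pCons 0 (\<Prod>i = 0..<N. A $$ (i, \<sigma> i))) W)"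
      by (cases W) (simp_all add: det coeff_sum coeff_signof_mult)
    also have "\<dots> = det_variation N (\<lambda>i j. coeff (A $$ (i, j)) (e i j)) (\<lambda>i j. coeff (pCons 0 (A $$ (i, j))) (e i j))"
      unfolding det_variation_def by (intro sum.cong refl) (use main in auto)
    finally show ?thesis .
  qed
qed

text \<open>
  The reversed matrix \<open>B + z A\<close> has entries of degree at most \<open>1\<close>, so the variation is the
  coefficient of \<open>z\<^bsup>N-1\<^esup>\<close> in its determinant.  Properties of determinants carry over to variations
  in this way.
\<close>

lemma det_variation_eq_coeff:
  "det_variation N A B = coeff (pCons 0 (det (mat N N (\<lambda>(i, j). [:B i j, A i j:])))) N"
proof -
  let ?M = "mat N N (\<lambda>(i, j). [:B i j, A i j:])"
  have "coeff (pCons 0 (det ?M)) N =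
     det_variation N (\<lambda>i j. coeff (?M $$ (i, j)) 1) (\<lambda>i j. coeff (pCons 0 (?M $$ (i, j))) 1)"
    by (rule det_weighted(3)) auto
  also have "\<dots> = det_variation N A B"
    unfolding det_variation_def
    by (intro sum.cong refl arg_cong2[of _ _ _ _ "(*)"] prod.cong) (auto simp: permutes_in_image)
  finally show ?thesis by simp
qed

lemma det_variation_add:
  "det_variation N A (\<lambda>i j. B i j + C i j) = det_variation N A B + det_variation N A C"
  unfolding det_variation_def by (simp add: sum.distrib algebra_simps)

lemma det_variation_scale:
  "det_variation N A (\<lambda>i j. c * B i j) = c * det_variation N A B"
  unfolding det_variation_def by (simp add: sum_distrib_left algebra_simps)

lemma det_variation_cong:
  assumes "\<And>i j. i < N \<Longrightarrow> j < N \<Longrightarrow> A i j = A' i j" "\<And>i j. i < N \<Longrightarrow> j < N \<Longrightarrow> B i j = B' i j"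
  shows "det_variation N A B = det_variation N A' B'"
  unfolding det_variation_def using assms
  by (intro sum.cong refl arg_cong2[of _ _ _ _ "(*)"] prod.cong) (auto simp: permutes_in_image)

lemma det_reindex:
  fixes f :: "nat \<Rightarrow> nat \<Rightarrow> 'a :: comm_ring_1"
  assumes \<rho>: "\<rho> permutes {0..<N}" and \<tau>: "\<tau> permutes {0..<N}"
  shows "det (mat N N (\<lambda>(i, j). f (\<rho> i) (\<tau> j))) = signof \<rho> * signof \<tau> * det (mat N N (\<lambda>(i, j). f i j))"
proof -
  let ?A = "mat N N (\<lambda>(i, j). f i j)"
  let ?B = "mat N N (\<lambda>(i, j). ?A $$ (\<rho> i, j))"
  have 1: "det ?B = signof \<rho> * det ?A" by (rule det_permute_rows[OF _ \<rho>]) simp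
  have "det (mat N N (\<lambda>(i, j). transpose_mat ?B $$ (\<tau> i, j))) = signof \<tau> * det (transpose_mat ?B)"
    by (rule det_permute_rows[OF _ \<tau>]) simp
  also have "mat N N (\<lambda>(i, j). transpose_mat ?B $$ (\<tau> i, j)) = transpose_mat (mat N N (\<lambda>(i, j). f (\<rho> i) (\<tau> j)))"
    using permutes_in_image[OF \<rho>] permutes_in_image[OF \<tau>] by (intro eq_matI) auto
  also have "det \<dots> = det (mat N N (\<lambda>(i, j). f (\<rho> i) (\<tau> j)))"
    by (rule det_transpose[of _ N]) simp
  also have "det (transpose_mat ?B) = det ?B" by (rule det_transpose[of _ N]) simp
  finally show ?thesis unfolding 1 by (simp add: mult.assoc mult.left_commute)
qed

lemma det_variation_reindex:
  fixes A B :: "nat \<Rightarrow> nat \<Rightarrow> 'a :: comm_ring_1"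
  assumes \<rho>: "\<rho> permutes {0..<N}" and \<tau>: "\<tau> permutes {0..<N}"
  shows "det_variation N (\<lambda>i j. A (\<rho> i) (\<tau> j)) (\<lambda>i j. B (\<rho> i) (\<tau> j)) =
           signof \<rho> * signof \<tau> * det_variation N A B"
proof -
  have p0: "pCons 0 (signof \<rho> * (signof \<tau> * p)) = signof \<rho> * (signof \<tau> * pCons 0 p)" for p :: "'a poly"
    by (cases "sign \<rho> = 1"; cases "sign \<tau> = 1") (auto simp: sign_def)
  show ?thesis
    unfolding det_variation_eq_coeff
    by (simp only: det_reindex[OF assms, of "\<lambda>i j. [:B i j, A i j:]"] mult.assoc p0 coeff_signof_mult)
qed

text \<open>
  The matrix \<open>A + \<eta> B\<close> kills \<open>v\<close>, so its determinant is zero identically in \<open>\<eta>\<close>.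
\<close>

lemma det_variation_kernel:
  fixes A B :: "nat \<Rightarrow> nat \<Rightarrow> 'a :: idom"
  assumes "\<And>i. i < N \<Longrightarrow> (\<Sum>j<N. A i j * v j) = 0" "\<And>i. i < N \<Longrightarrow> (\<Sum>j<N. B i j * v j) = 0"
    and "k < N" "v k \<noteq> 0"
  shows "det_variation N A B = 0"
proof -
  let ?M = "mat N N (\<lambda>(i, j). [:B i j, A i j:])"
  let ?v = "vec N (\<lambda>j. [:v j:])"
  have "det ?M = 0"
  proof (subst det_0_iff_vec_prod_zero[of _ N])
    have "?v \<noteq> 0\<^sub>v N"
    proof
      assume "?v = 0\<^sub>v N"
      from arg_cong[OF this, of "\<lambda>u. vec_index u k"] show False using assms(3,4) by simp
    qed
    moreover have "?M *\<^sub>v ?v = 0\<^sub>v N"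
    proof (rule eq_vecI)
      fix i assume "i < dim_vec (0\<^sub>v N :: 'a poly vec)"
      then have i: "i < N" by simp
      then have "vec_index (?M *\<^sub>v ?v) i = (\<Sum>j<N. [:B i j, A i j:] * [:v j:])"
        by (simp add: scalar_prod_def atLeast0LessThan)
      also have "\<dots> = [:\<Sum>j<N. B i j * v j, \<Sum>j<N. A i j * v j:]"
        by (induction N) (auto simp: mult.commute)
      finally show "vec_index (?M *\<^sub>v ?v) i = vec_index (0\<^sub>v N) i" using assms(1,2) i by simp
    qed simp
    ultimately show "\<exists>v. v \<in> carrier_vec N \<and> v \<noteq> 0\<^sub>v N \<and> ?M *\<^sub>v v = 0\<^sub>v N" by (intro exI[of _ ?v]) auto
  qed simp
  then show ?thesis unfolding det_variation_eq_coeff by simp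
qed

section \<open>Padded Sylvester matrices\<close>

text \<open>
  The homogeneous part of degree \<open>k\<close> of a polynomial in \<open>x\<close> and \<open>y\<close>, dehomogenized at \<open>x = 1\<close>.
\<close>

definition homog_part :: "nat \<Rightarrow> 'a poly poly \<Rightarrow> 'a :: comm_ring_1 poly" where
  "homog_part k p = (\<Sum>j\<le>k. monom (coeff (coeff p j) (k - j)) j)"

text \<open>
  The bound is a predicate because the coefficients also range over rings like \<open>\<complex>[t]\<close>, for which
  \<open>total_degree\<close> is not defined.
\<close>

definition total_degree_le :: "nat \<Rightarrow> 'a :: zero poly poly \<Rightarrow> bool" where
  "total_degree_le m p \<longleftrightarrow> (\<forall>i j. coeff (coeff p j) i \<noteq> 0 \<longrightarrow> i + j \<le> m)"

lemma coeff_homog_part: "coeff (homog_part k p) j = (if j \<le> k then coeff (coeff p j) (k - j) else 0)"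
  unfolding homog_part_def coeff_sum by (simp add: sum.delta coeff_monom)

lemma degree_homog_part: "degree (homog_part k p) \<le> k"
  by (rule degree_le) (simp add: coeff_homog_part)

lemma poly_eq_sum_upto:
  fixes p :: "'a :: comm_ring_1 poly"
  assumes "degree p \<le> n"
  shows "poly p x = (\<Sum>i\<le>n. coeff p i * x ^ i)"
  unfolding poly_altdef
  by (rule sum.mono_neutral_left) (use assms in \<open>auto simp: coeff_eq_0\<close>)

text \<open>
  The rows of the Sylvester matrix are the coefficients of \<open>y\<^sup>i P\<close> and \<open>y\<^sup>i Q\<close>, so applying it to the
  vector of powers of \<open>\<beta>\<close> evaluates these polynomials at \<open>\<beta>\<close>.
\<close>

lemma sylvester_kernel:
  fixes P Q :: "'a :: comm_ring_1 poly"
  assumes "degree P \<le> m" "degree Q \<le> n" "poly P \<beta> = 0" "poly Q \<beta> = 0" "i < m + n"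
  shows "(\<Sum>j<m+n. sylvester_mat_sub m n P Q $$ (i, j) * \<beta> ^ (m + n - 1 - j)) = 0"
proof (cases "i < n")
  case True
  have "(\<Sum>j<m+n. sylvester_mat_sub m n P Q $$ (i, j) * \<beta> ^ (m + n - 1 - j)) =
        (\<Sum>j\<in>{i..i+m}. coeff P (m + i - j) * \<beta> ^ (m + n - 1 - j))"
    by (rule sum.mono_neutral_cong_right) (use assms(5) True in \<open>auto simp: sylvester_mat_sub_index\<close>)
  also have "\<dots> = (\<Sum>k\<le>m. coeff P k * \<beta> ^ (n - 1 - i + k))"
    by (rule sum.reindex_bij_witness[of _ "\<lambda>k. m + i - k" "\<lambda>j. m + i - j"])
      (use True in \<open>auto intro!: arg_cong2[of _ _ _ _ "(*)"] arg_cong[of _ _ "\<lambda>k. \<beta> ^ k"]\<close>)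
  also have "\<dots> = \<beta> ^ (n - 1 - i) * poly P \<beta>"
    using poly_eq_sum_upto[OF assms(1), of \<beta>] by (simp add: power_add sum_distrib_left mult_ac)
  finally show ?thesis using assms by simp
next
  case False
  then obtain i' where i: "i = n + i'" using le_Suc_ex not_less by blast
  with assms(5) have i': "i' < m" by simp
  have "(\<Sum>j<m+n. sylvester_mat_sub m n P Q $$ (i, j) * \<beta> ^ (m + n - 1 - j)) =
        (\<Sum>j\<in>{i'..n+i'}. coeff Q (n + i' - j) * \<beta> ^ (m + n - 1 - j))"
    by (rule sum.mono_neutral_cong_right) (use assms(5) i in \<open>auto simp: sylvester_mat_sub_index\<close>)
  also have "\<dots> = (\<Sum>k\<le>n. coeff Q k * \<beta> ^ (m - 1 - i' + k))"
    by (rule sum.reindex_bij_witness[of _ "\<lambda>k. n + i' - k" "\<lambda>j. n + i' - j"])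
      (use i' in \<open>auto intro!: arg_cong2[of _ _ _ _ "(*)"] arg_cong[of _ _ "\<lambda>k. \<beta> ^ k"]\<close>)
  also have "\<dots> = \<beta> ^ (m - 1 - i') * poly Q \<beta>"
    using poly_eq_sum_upto[OF assms(2), of \<beta>] by (simp add: power_add sum_distrib_left mult_ac)
  finally show ?thesis using assms by simp
qed

lemma resultant_sub_eq_0_if_common_root:
  fixes P Q :: "'a :: idom poly"
  assumes "degree P \<le> m" "degree Q \<le> n" "poly P \<beta> = 0" "poly Q \<beta> = 0" "m + n > 0"
  shows "resultant_sub m n P Q = 0"
proof -
  let ?M = "sylvester_mat_sub m n P Q" and ?v = "vec (m + n) (\<lambda>j. \<beta> ^ (m + n - 1 - j))"
  have "?v \<noteq> 0\<^sub>v (m + n)"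
  proof
    assume "?v = 0\<^sub>v (m + n)"
    from arg_cong[OF this, of "\<lambda>u. vec_index u (m + n - 1)"] assms(5) show False by simp
  qed
  moreover have "?M *\<^sub>v ?v = 0\<^sub>v (m + n)"
    by (rule eq_vecI) (use sylvester_kernel[OF assms(1-4)] in \<open>auto simp: scalar_prod_def atLeast0LessThan\<close>)
  ultimately show ?thesis
    unfolding resultant_sub_def
    by (subst det_0_iff_vec_prod_zero[OF sylvester_mat_sub_carrier]) (intro exI[of _ ?v], auto)
qed

lemma resultant_sub_Suc:
  fixes P Q :: "'a :: comm_ring_1 poly"
  assumes "coeff P (Suc m) = 0" 
  shows "resultant_sub (Suc m) n P Q = (-1) ^ n * coeff Q n * resultant_sub m n P Q"
proof -
  let ?M = "sylvester_mat_sub (Suc m) n P Q"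
  have "det ?M = (\<Sum>i<Suc m + n. ?M $$ (i, 0) * cofactor ?M i 0)"
    by (rule laplace_expansion_column[OF sylvester_mat_sub_carrier]) simp
  also have "\<dots> = (\<Sum>i\<in>{n}. ?M $$ (i, 0) * cofactor ?M i 0)"
    by (rule sum.mono_neutral_right) (use assms in \<open>auto simp: sylvester_mat_sub_index\<close>)
  also have "\<dots> = coeff Q n * cofactor ?M n 0" by (simp add: sylvester_mat_sub_index)
  also have "cofactor ?M n 0 = (-1) ^ n * det (mat_delete ?M n 0)" by (simp add: cofactor_def)
  also have "mat_delete ?M n 0 = sylvester_mat_sub m n P Q"
    by (rule eq_matI) (auto simp: mat_delete_def sylvester_mat_sub_index le_Suc_eq assms)
  finally show ?thesis by (simp add: resultant_sub_def mult_ac)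
qed

text \<open>
  The degree of the pencil in \<open>y\<close> may be smaller than \<open>d - 2\<close>, and it may differ from its degree in \<open>x\<close>.
  Padding \<open>P\<close> with zero leading coefficients changes the resultant only by a power of the leading
  coefficient of \<open>Q\<close>, and makes the resultants with respect to \<open>x\<close> and \<open>y\<close> comparable.
\<close>

lemma resultant_sub_pad:
  fixes P Q :: "'a :: comm_ring_1 poly"
  assumes "degree P \<le> m"
  shows "resultant_sub m (degree Q) P Q = ((-1) ^ degree Q * lead_coeff Q) ^ (m - degree P) * resultant P Q"
  using assms
proof (induction m rule: dec_induct)
  case base
  then show ?case by (simp add: resultant_sub)
next
  case (step m)
  then show ?case
    by (simp add: resultant_sub_Suc coeff_eq_0 Suc_diff_le mult_ac)
qed

lemma resultant_sub_eq_0_imp_common_root: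
  fixes P Q :: "complex poly"
  assumes "degree P \<le> m" "degree Q = n" "n > 0" "resultant_sub m n P Q = 0"
  shows "\<exists>\<beta>. poly P \<beta> = 0 \<and> poly Q \<beta> = 0"
proof -
  have "lead_coeff Q \<noteq> 0" using assms by auto
  with assms resultant_sub_pad[OF assms(1), of Q] have "resultant P Q = 0" by auto
  then have "degree (gcd P Q) \<noteq> 0" by (simp add: resultant_0_gcd)
  then obtain \<beta> where "poly (gcd P Q) \<beta> = 0"
    using fundamental_theorem_of_algebra[of "gcd P Q"] by (auto simp: constant_degree)
  then show ?thesis by (meson dvd_trans gcd_dvd1 gcd_dvd2 poly_eq_0_iff_dvd)
qed

text \<open>
  Reversing the coefficients permutes the rows within the two blocks and reverses the columns.  The
  sign does not depend on the polynomials, which is why it is quantified first: the same sign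
  must serve for the determinant and for its variation.
\<close>

lemma sylvester_reverse:
  "\<exists>s::'a::comm_ring_1. (s = 1 \<or> s = -1) \<and>
    (\<forall>P Q P' Q' U V U' V'.
       (\<forall>k\<le>m. coeff P' k = coeff P (m - k)) \<longrightarrow> (\<forall>k\<le>n. coeff Q' k = coeff Q (n - k)) \<longrightarrow>
       (\<forall>k\<le>m. coeff U' k = coeff U (m - k)) \<longrightarrow> (\<forall>k\<le>n. coeff V' k = coeff V (n - k)) \<longrightarrow>
       resultant_sub m n P' Q' = s * resultant_sub m n P Q \<and>
       det_variation (m + n) (\<lambda>i j. sylvester_mat_sub m n P' Q' $$ (i, j)) (\<lambda>i j. sylvester_mat_sub m n U' V' $$ (i, j)) =
       s * det_variation (m + n) (\<lambda>i j. sylvester_mat_sub m n P Q $$ (i, j)) (\<lambda>i j. sylvester_mat_sub m n U V $$ (i, j)))"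
proof -
  \<comment> \<open>\<open>\<rho>\<close> reverses the \<open>n\<close> rows of the first block and the \<open>m\<close> rows of the second one, \<open>\<tau>\<close> reverses
    the columns.\<close>
  define \<rho> where "\<rho> = (\<lambda>i. if i < n then n - 1 - i else if i < m + n then m + 2 * n - 1 - i else i)"
  define \<tau> where "\<tau> = (\<lambda>j. if j < m + n then m + n - 1 - j else j)"
  have \<rho>: "\<rho> permutes {0..<m+n}"
    by (rule bij_imp_permutes, rule bij_betw_byWitness[of _ \<rho>]) (auto simp: \<rho>_def)
  have \<tau>: "\<tau> permutes {0..<m+n}"
    by (rule bij_imp_permutes, rule bij_betw_byWitness[of _ \<tau>]) (auto simp: \<tau>_def)
  have entry: "sylvester_mat_sub m n P' Q' $$ (\<rho> i, \<tau> j) = sylvester_mat_sub m n P Q $$ (i, j)"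
    if "\<forall>k\<le>m. coeff P' k = coeff P (m - k)" "\<forall>k\<le>n. coeff Q' k = coeff Q (n - k)" "i < m + n" "j < m + n"
    for P Q P' Q' :: "'a poly" and i j
  proof (cases "i < n")
    case True
    have ij: "\<rho> i < n" "\<rho> i < m + n" "\<tau> j < m + n" "\<rho> i = n - 1 - i" "\<tau> j = m + n - 1 - j"
      using True that by (auto simp: \<rho>_def \<tau>_def)
    have c: "(n - 1 - i \<le> m + n - 1 - j \<and> (m + n - 1 - j) - (n - 1 - i) \<le> m) \<longleftrightarrow> (i \<le> j \<and> j - i \<le> m)"
      using True that(4) by auto
    have "coeff P' (m + (n - 1 - i) - (m + n - 1 - j)) = coeff P (m + i - j)" if "i \<le> j" "j - i \<le> m"
    proof -
      have "m + (n - 1 - i) - (m + n - 1 - j) = j - i" "m - (j - i) = m + i - j"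
        using True \<open>j < m + n\<close> that by auto
      then show ?thesis using \<open>\<forall>k\<le>m. coeff P' k = coeff P (m - k)\<close> that by simp
    qed
    then show ?thesis
      unfolding sylvester_mat_sub_index[OF ij(2,3)] sylvester_mat_sub_index[OF that(3,4)]
      using ij True c by auto
  next
    case False
    then obtain i' where i: "i = n + i'" using le_Suc_ex not_less by blast
    have ij: "\<not> \<rho> i < n" "\<rho> i < m + n" "\<tau> j < m + n" "\<rho> i = n + (m - 1 - i')" "\<tau> j = m + n - 1 - j"
      using i that by (auto simp: \<rho>_def \<tau>_def)
    have c: "(m - 1 - i' \<le> m + n - 1 - j \<and> m + n - 1 - j \<le> n + (m - 1 - i')) \<longleftrightarrow> (i' \<le> j \<and> j \<le> n + i')"
      using i that(3,4) by auto
    have "coeff Q' (n + (m - 1 - i') - (m + n - 1 - j)) = coeff Q (n + i' - j)" if "i' \<le> j" "j \<le> n + i'"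
    proof -
      have "n + (m - 1 - i') - (m + n - 1 - j) = j - i'" "n - (j - i') = n + i' - j"
        using i \<open>i < m + n\<close> \<open>j < m + n\<close> that by auto
      then show ?thesis using \<open>\<forall>k\<le>n. coeff Q' k = coeff Q (n - k)\<close> that by simp
    qed
    then show ?thesis
      unfolding sylvester_mat_sub_index[OF ij(2,3)] sylvester_mat_sub_index[OF that(3,4)]
      using ij i c by auto
  qed
  define s :: 'a where "s = signof \<rho> * signof \<tau>"
  have s: "s = 1 \<or> s = -1" unfolding s_def by (cases "sign \<rho> = 1"; cases "sign \<tau> = 1") (auto simp: sign_def)
  then have ss: "s * (s * x) = x" for x by auto
  show ?thesis
  proof (intro exI[of _ s] conjI allI impI)
    fix P Q P' Q' U V U' V' :: "'a poly"
    assume P: "\<forall>k\<le>m. coeff P' k = coeff P (m - k)" "\<forall>k\<le>n. coeff Q' k = coeff Q (n - k)"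
      and U: "\<forall>k\<le>m. coeff U' k = coeff U (m - k)" "\<forall>k\<le>n. coeff V' k = coeff V (n - k)"
    let ?S = "\<lambda>P Q i j. sylvester_mat_sub m n P Q $$ (i, j)"
    have mat: "mat (m + n) (m + n) (\<lambda>(i, j). ?S P Q i j) = sylvester_mat_sub m n P Q" for P Q :: "'a poly"
      by (rule eq_matI) auto
    have "resultant_sub m n P Q = det (mat (m + n) (m + n) (\<lambda>(i, j). ?S P' Q' (\<rho> i) (\<tau> j)))"
      unfolding resultant_sub_def by (rule arg_cong[of _ _ Determinant.det], rule eq_matI) (auto simp: entry[OF P])
    also have "\<dots> = s * resultant_sub m n P' Q'"
      unfolding det_reindex[OF \<rho> \<tau>, of "?S P' Q'"] mat s_def resultant_sub_def ..
    finally show "resultant_sub m n P' Q' = s * resultant_sub m n P Q" by (simp add: ss)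
    have "det_variation (m + n) (?S P Q) (?S U V) =
      det_variation (m + n) (\<lambda>i j. ?S P' Q' (\<rho> i) (\<tau> j)) (\<lambda>i j. ?S U' V' (\<rho> i) (\<tau> j))"
      by (rule det_variation_cong) (simp_all add: entry[OF P] entry[OF U])
    also have "\<dots> = s * det_variation (m + n) (?S P' Q') (?S U' V')"
      unfolding s_def by (rule det_variation_reindex[OF \<rho> \<tau>])
    finally show "det_variation (m + n) (?S P' Q') (?S U' V') = s * det_variation (m + n) (?S P Q) (?S U V)"
      by (simp add: ss)
  qed (rule s)
qed

text \<open>
  The entry of the Sylvester matrix of \<open>p\<close> and \<open>q\<close> in row \<open>i\<close> and column \<open>j\<close> is a coefficient of
  degree at most \<open>j - i\<close> in \<open>x\<close> (row \<open>i\<close> of the \<open>p\<close>-block) or \<open>j - i'\<close> (row \<open>i'\<close> of the \<open>q\<close>-block), and along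
  any permutation these bounds add up to \<open>m n\<close>.  The two highest coefficients of the entries belong
  to the forms of the two highest degrees.
\<close>

lemma resultant_sub_top_coeffs:
  fixes p q :: "'a :: comm_ring_1 poly poly"
  assumes p: "total_degree_le m p" and q: "total_degree_le n q" and mn: "m > 0" "n > 0"
  shows "degree (resultant_sub m n p q) \<le> m * n"
    and "coeff (resultant_sub m n p q) (m * n) = resultant_sub m n (homog_part m p) (homog_part n q)"
    and "coeff (pCons 0 (resultant_sub m n p q)) (m * n) = det_variation (m + n)
           (\<lambda>i j. sylvester_mat_sub m n (homog_part m p) (homog_part n q) $$ (i, j))
           (\<lambda>i j. sylvester_mat_sub m n (homog_part (m - 1) p) (homog_part (n - 1) q) $$ (i, j))"
proof -
  let ?A = "sylvester_mat_sub m n p q"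
  \<comment> \<open>The weight of an entry is its column minus its row within the block.\<close>
  define r where "r = (\<lambda>i. if i < n then i else i - n)"
  define e where "e = (\<lambda>i j. j - r i :: nat)"
  have degp: "degree (coeff p k) \<le> m - k" for k
    by (rule degree_le) (use p in \<open>fastforce simp: total_degree_le_def\<close>)
  have degq: "degree (coeff q k) \<le> n - k" for k
    by (rule degree_le) (use q in \<open>fastforce simp: total_degree_le_def\<close>)
  have 1: "degree (?A $$ (i, j)) \<le> e i j" if "i < m + n" "j < m + n" for i j
    using that degp[of "m + i - j"] degq[of "i - j"]
    by (auto simp: sylvester_mat_sub_index e_def r_def)
  have 2: "(\<Sum>i\<in>{0..<m+n}. e i (\<sigma> i)) = m * n"
    if \<sigma>: "\<sigma> permutes {0..<m+n}" and nz: "\<And>i. i < m + n \<Longrightarrow> ?A $$ (i, \<sigma> i) \<noteq> 0" for \<sigma>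
  proof -
    have "r i \<le> \<sigma> i" if "i < m + n" for i
    proof -
      have "\<sigma> i < m + n" using permutes_in_image[OF \<sigma>, of i] that by simp
      then show ?thesis using nz[OF that] that by (auto simp: sylvester_mat_sub_index r_def split: if_splits)
    qed
    then have "(\<Sum>i\<in>{0..<m+n}. e i (\<sigma> i) + r i) = (\<Sum>i\<in>{0..<m+n}. \<sigma> i)"
      by (intro sum.cong) (auto simp: e_def)
    also have "\<dots> = (\<Sum>i\<in>{0..<m+n}. i)"
      using sum.permute[OF \<sigma>, of "\<lambda>i. i"] by (simp add: comp_def)
    also have "\<dots> = (\<Sum>i\<in>{0..<m+n}. r i + (if i < n then 0 else n))"
      by (intro sum.cong) (auto simp: r_def)
    also have "\<dots> = (\<Sum>i\<in>{0..<m+n}. r i) + m * n"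
    proof -
      have "(\<Sum>i\<in>{0..<m+n}. if i < n then 0 else n) = (\<Sum>i\<in>{n..<m+n}. n)"
        by (rule sum.mono_neutral_cong_right) auto
      then show ?thesis by (simp add: sum.distrib)
    qed
    finally show ?thesis by (simp add: sum.distrib)
  qed
  have A: "?A \<in> carrier_mat (m + n) (m + n)" by (rule sylvester_mat_sub_carrier)
  have 3: "coeff (?A $$ (i, j)) (e i j) = sylvester_mat_sub m n (homog_part m p) (homog_part n q) $$ (i, j)"
    if "i < m + n" "j < m + n" for i j
    using that
    by (auto simp: sylvester_mat_sub_index e_def r_def coeff_homog_part intro!: arg_cong[of _ _ "coeff (coeff _ _)"])
  have 4: "coeff (pCons 0 (?A $$ (i, j))) (e i j) =
      sylvester_mat_sub m n (homog_part (m - 1) p) (homog_part (n - 1) q) $$ (i, j)"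
    if "i < m + n" "j < m + n" for i j
    using that mn
    by (cases "e i j") (auto simp: sylvester_mat_sub_index e_def r_def coeff_homog_part split: if_splits
        intro!: arg_cong[of _ _ "coeff (coeff _ _)"])
  have deg: "\<forall>i<m+n. \<forall>j<m+n. degree (?A $$ (i, j)) \<le> e i j" using 1 by blast
  have weight: "\<forall>\<sigma>. \<sigma> permutes {0..<m+n} \<longrightarrow> (\<forall>i<m+n. ?A $$ (i, \<sigma> i) \<noteq> 0) \<longrightarrow>
      (\<Sum>i\<in>{0..<m+n}. e i (\<sigma> i)) = m * n" using 2 by blast
  note main = det_weighted[OF A deg weight]
  show "degree (resultant_sub m n p q) \<le> m * n" using main(1) by (simp add: resultant_sub_def)
  show "coeff (resultant_sub m n p q) (m * n) = resultant_sub m n (homog_part m p) (homog_part n q)"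
    unfolding resultant_sub_def main(2)
    by (rule arg_cong[of _ _ Determinant.det], rule eq_matI) (auto simp: 3)
  show "coeff (pCons 0 (resultant_sub m n p q)) (m * n) = det_variation (m + n)
           (\<lambda>i j. sylvester_mat_sub m n (homog_part m p) (homog_part n q) $$ (i, j))
           (\<lambda>i j. sylvester_mat_sub m n (homog_part (m - 1) p) (homog_part (n - 1) q) $$ (i, j))"
    unfolding resultant_sub_def main(3) by (rule det_variation_cong) (auto simp: 3 4)
qed

text \<open>
  As \<open>y U = (y - \<beta>) U + \<beta> U\<close>, and similarly for \<open>V\<close>, it suffices that the variation vanishes in
  the direction \<open>((y - \<beta>) U, (y - \<beta>) V)\<close>.  It does, since the vector of powers of \<open>\<beta>\<close> is in the kernel
  of both Sylvester matrices.  This is what ties the second coordinate of the parametrization to the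
  first one at infinity.
\<close>

lemma sylvester_variation_direction:
  fixes P Q U V :: "'a :: idom poly"
  assumes "degree P \<le> m" "degree Q \<le> n" "poly P \<beta> = 0" "poly Q \<beta> = 0"
    and U: "degree U < m" "degree V < n"
  shows "det_variation (m + n) (\<lambda>i j. sylvester_mat_sub m n P Q $$ (i, j))
           (\<lambda>i j. sylvester_mat_sub m n (pCons 0 U) (pCons 0 V) $$ (i, j)) =
         \<beta> * det_variation (m + n) (\<lambda>i j. sylvester_mat_sub m n P Q $$ (i, j))
           (\<lambda>i j. sylvester_mat_sub m n U V $$ (i, j))"
proof -
  let ?S = "\<lambda>P Q i j. sylvester_mat_sub m n P Q $$ (i, j)" and ?l = "[:-\<beta>, 1:]"
  have deg: "degree (?l * U) \<le> m" "degree (?l * V) \<le> n"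
    using U degree_mult_le[of ?l U] degree_mult_le[of ?l V] by auto
  have root: "poly (?l * U) \<beta> = 0" "poly (?l * V) \<beta> = 0" by auto
  have "det_variation (m + n) (?S P Q) (?S (?l * U) (?l * V)) = 0"
    by (rule det_variation_kernel[of _ _ "\<lambda>j. \<beta> ^ (m + n - 1 - j)" _ "m + n - 1"])
      (rule sylvester_kernel[OF assms(1-4)] sylvester_kernel[OF deg root] | use U in simp)+
  moreover have "det_variation (m + n) (?S P Q) (?S (pCons 0 U) (pCons 0 V)) =
    det_variation (m + n) (?S P Q) (\<lambda>i j. ?S (?l * U) (?l * V) i j + \<beta> * ?S U V i j)"
    by (rule det_variation_cong) (auto simp: sylvester_mat_sub_index)
  ultimately show ?thesis by (simp add: det_variation_add det_variation_scale)
qed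

lemma degree_det_variation:
  fixes A B :: "nat \<Rightarrow> nat \<Rightarrow> 'a :: comm_ring_1 poly"
  assumes "\<And>i j. i < N \<Longrightarrow> j < N \<Longrightarrow> degree (A i j) \<le> r i" "\<And>i j. i < N \<Longrightarrow> j < N \<Longrightarrow> degree (B i j) \<le> r i"
  shows "degree (det_variation N A B) \<le> (\<Sum>i<N. r i)"
  unfolding det_variation_def
proof (intro degree_sum_le)
  fix \<sigma> assume "\<sigma> \<in> {\<sigma>. \<sigma> permutes {0..<N}}"
  then have \<sigma>: "\<sigma> i < N" if "i < N" for i using that permutes_in_image[of \<sigma> "{0..<N}" i] by auto
  have "degree (\<Sum>i\<in>{0..<N}. B i (\<sigma> i) * (\<Prod>k\<in>{0..<N} - {i}. A k (\<sigma> k))) \<le> (\<Sum>i<N. r i)"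
  proof (intro degree_sum_le)
    fix i assume i: "i \<in> {0..<N}"
    have "degree (\<Prod>k\<in>{0..<N} - {i}. A k (\<sigma> k)) \<le> (\<Sum>k\<in>{0..<N} - {i}. r k)"
      by (rule prod_coeffs_at_bounds(1)) (use assms \<sigma> in auto)
    moreover have "degree (B i (\<sigma> i)) \<le> r i" using assms \<sigma> i by auto
    moreover have "(\<Sum>i<N. r i) = r i + (\<Sum>k\<in>{0..<N} - {i}. r k)"
      using i by (simp add: sum.remove atLeast0LessThan)
    ultimately show "degree (B i (\<sigma> i) * (\<Prod>k\<in>{0..<N} - {i}. A k (\<sigma> k))) \<le> (\<Sum>i<N. r i)"
      using degree_mult_le[of "B i (\<sigma> i)" "\<Prod>k\<in>{0..<N} - {i}. A k (\<sigma> k)"] by linarith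
  qed simp
  then show "degree (signof \<sigma> * (\<Sum>i\<in>{0..<N}. B i (\<sigma> i) * (\<Prod>k\<in>{0..<N} - {i}. A k (\<sigma> k)))) \<le> (\<Sum>i<N. r i)"
    by (cases "sign \<sigma> = 1") (auto simp: sign_def)
qed (simp add: finite_permutations)

lemma poly_det_variation:
  "poly (det_variation N A B) t = det_variation N (\<lambda>i j. poly (A i j) t) (\<lambda>i j. poly (B i j) t)"
  unfolding det_variation_def by (simp add: poly_sum poly_prod)

lemma poly_resultant_sub:
  "poly (resultant_sub m n P Q) t = resultant_sub m n (map_poly (\<lambda>c. poly c t) P) (map_poly (\<lambda>c. poly c t) Q)"
  unfolding resultant_sub_def comm_ring_hom.hom_det[OF poly_hom.comm_ring_hom_axioms, symmetric]
  by (rule arg_cong[of _ _ Determinant.det]) (simp add: sylvester_mat_sub_map)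

text \<open>
  Only the \<open>n\<close> rows that carry coefficients of \<open>P\<close> depend on \<open>t\<close>, each of them linearly.
\<close>

lemma resultant_sub_pencil:
  fixes P Q :: "'a :: comm_ring_1 poly poly"
  assumes "\<And>k. degree (coeff P k) \<le> 1" "\<And>k. degree (coeff Q k) = 0"
  shows "degree (resultant_sub m n P Q) \<le> n"
    and "coeff (resultant_sub m n P Q) n = resultant_sub m n (map_poly (\<lambda>c. coeff c 1) P) (map_poly (\<lambda>c. coeff c 0) Q)"
proof -
  let ?A = "sylvester_mat_sub m n P Q"
  let ?e = "\<lambda>i j::nat. if i < n then 1 else 0 :: nat"
  have "(\<Sum>i\<in>{0..<m+n}. ?e i i) = (\<Sum>i\<in>{0..<n}. 1)"
    by (rule sum.mono_neutral_cong_right) auto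
  then have sum: "(\<Sum>i\<in>{0..<m+n}. ?e i i) = n" by simp
  have deg: "\<forall>i<m+n. \<forall>j<m+n. degree (?A $$ (i, j)) \<le> ?e i j"
    using assms by (auto simp: sylvester_mat_sub_index)
  have e: "\<forall>\<sigma>. \<sigma> permutes {0..<m+n} \<longrightarrow> (\<forall>i<m+n. ?A $$ (i, \<sigma> i) \<noteq> 0) \<longrightarrow>
      (\<Sum>i\<in>{0..<m+n}. ?e i (\<sigma> i)) = n" using sum by simp
  note main = det_weighted[of ?A "m + n" ?e n, OF sylvester_mat_sub_carrier deg e]
  show "degree (resultant_sub m n P Q) \<le> n" using main(1) by (simp add: resultant_sub_def)
  show "coeff (resultant_sub m n P Q) n = resultant_sub m n (map_poly (\<lambda>c. coeff c 1) P) (map_poly (\<lambda>c. coeff c 0) Q)"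
    unfolding resultant_sub_def main(2)
    by (rule arg_cong[of _ _ Determinant.det], rule eq_matI) (auto simp: sylvester_mat_sub_index coeff_map_poly)
qed

section \<open>Bivariate polynomials, their forms and restriction to lines through the origin\<close>

lemma eval2_add [simp]: "eval2 (p + q) P = eval2 p P + eval2 q P"
  and eval2_mult [simp]: "eval2 (p * q) P = eval2 p P * eval2 q P"
  and eval2_0 [simp]: "eval2 0 P = 0"
  and eval2_1 [simp]: "eval2 1 P = 1"
  and eval2_diff [simp]: "eval2 (p - q) P = eval2 p P - eval2 q P"
  by (simp_all add: eval2_def)

lemma eval2_smult [simp]: "eval2 (Polynomial.smult c p) P = poly c (fst P) * eval2 p P"
  by (simp add: eval2_def)

lemma eval2_hom: "comm_ring_hom (\<lambda>p. eval2 p P)"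
  by unfold_locales simp_all

lemma eval2_mono2 [simp]: "eval2 (mono2 c i j) (x, y) = c * x ^ i * y ^ j"
  by (simp add: eval2_def mono2_def poly_monom)

lemma eval2_const [simp]: "eval2 [:[:c:]:] P = c"
  by (simp add: eval2_def)

text \<open>
  The value at \<open>(a, b)\<close> of the homogeneous part of degree \<open>k\<close> of \<open>p\<close>.
\<close>

definition form_value :: "nat \<Rightarrow> poly2 \<Rightarrow> complex \<Rightarrow> complex \<Rightarrow> complex" where
  "form_value k p a b = (\<Sum>j\<le>k. coeff (coeff p j) (k - j) * a ^ (k - j) * b ^ j)"

lemma finite_support: "finite {i + j | i j. coeff (coeff p j) i \<noteq> 0}" for p :: poly2
proof -
  have "finite (\<Union>j\<in>{..degree p}. (\<lambda>i. i + j) ` {..degree (coeff p j)})" by auto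
  moreover have "{i + j | i j. coeff (coeff p j) i \<noteq> 0} \<subseteq> (\<Union>j\<in>{..degree p}. (\<lambda>i. i + j) ` {..degree (coeff p j)})"
  proof
    fix k assume "k \<in> {i + j | i j. coeff (coeff p j) i \<noteq> 0}"
    then obtain i j where k: "k = i + j" and nz: "coeff (coeff p j) i \<noteq> 0" by blast
    then have "i \<le> degree (coeff p j)" "coeff p j \<noteq> 0" by (auto simp: le_degree)
    then have "j \<le> degree p" by (simp add: le_degree)
    then show "k \<in> (\<Union>j\<in>{..degree p}. (\<lambda>i. i + j) ` {..degree (coeff p j)})"
      using k \<open>i \<le> _\<close> by auto
  qed
  ultimately show ?thesis by (rule finite_subset[rotated])
qed

lemma total_degree_le_iff: "total_degree p \<le> m \<longleftrightarrow> total_degree_le m p"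
  unfolding total_degree_def total_degree_le_def
  by (subst Max_le_iff) (use finite_support[of p] in auto)

lemma total_degree_le_self: "total_degree_le (total_degree p) p"
  using total_degree_le_iff by blast

lemma total_degree_attained:
  assumes "p \<noteq> 0"
  obtains i j where "coeff (coeff p j) i \<noteq> 0" "i + j = total_degree p"
proof -
  let ?S = "{i + j | i j. coeff (coeff p j) i \<noteq> 0}"
  have "coeff (coeff p (degree p)) (degree (coeff p (degree p))) \<noteq> 0" using assms by simp
  then have "?S \<noteq> {}" by blast
  then have "Max (insert 0 ?S) = Max ?S" using finite_support[of p] by (simp add: Max_insert)
  then have "total_degree p \<in> ?S"
    unfolding total_degree_def using Max_in[OF finite_support \<open>?S \<noteq> {}\<close>] by simp
  then show ?thesis using that by auto
qed

lemma total_degree_le_add: "total_degree_le m p \<Longrightarrow> total_degree_le m q \<Longrightarrow> total_degree_le m (p + q)"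
  for p q :: "'a :: comm_ring_1 poly poly"
  unfolding total_degree_le_def by (metis add.right_neutral coeff_add)

lemma total_degree_le_sum:
  fixes f :: "'i \<Rightarrow> 'a :: comm_ring_1 poly poly"
  assumes "\<And>i. i \<in> I \<Longrightarrow> total_degree_le m (f i)"
  shows "total_degree_le m (\<Sum>i\<in>I. f i)"
  using assms
proof (induction I rule: infinite_finite_induct)
  case (insert x F)
  then show ?case by (simp add: total_degree_le_add)
qed (auto simp: total_degree_le_def)

lemma total_degree_le_mult:
  fixes p q :: "'a :: comm_ring_1 poly poly"
  assumes "total_degree_le m p" "total_degree_le n q"
  shows "total_degree_le (m + n) (p * q)"
  unfolding total_degree_le_def
proof (intro allI impI, rule ccontr)
  fix i j assume nz: "coeff (coeff (p * q) j) i \<noteq> 0" and gt: "\<not> i + j \<le> m + n"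
  have "coeff (coeff (p * q) j) i =
    (\<Sum>l\<le>j. \<Sum>k\<le>i. coeff (coeff p l) k * coeff (coeff q (j - l)) (i - k))"
    by (simp add: coeff_mult coeff_sum)
  also have "\<dots> = 0"
  proof (intro sum.neutral ballI)
    fix l k assume "l \<in> {..j}" "k \<in> {..i}"
    then have "k + l > m \<or> (i - k) + (j - l) > n" using gt by auto
    then show "coeff (coeff p l) k * coeff (coeff q (j - l)) (i - k) = 0"
      using assms unfolding total_degree_le_def by (metis mult_zero_left mult_zero_right not_le)
  qed
  finally show False using nz by simp
qed

lemma total_degree_le_prod:
  fixes f :: "'i \<Rightarrow> 'a :: comm_ring_1 poly poly"
  assumes "finite I" "\<And>i. i \<in> I \<Longrightarrow> total_degree_le 1 (f i)"
  shows "total_degree_le (card I) (\<Prod>i\<in>I. f i)"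
  using assms
proof (induction I rule: finite_induct)
  case empty
  then show ?case by (auto simp: total_degree_le_def coeff_1 split: if_splits)
next
  case (insert x F)
  then have "total_degree_le (1 + card F) (f x * (\<Prod>i\<in>F. f i))" by (intro total_degree_le_mult) auto
  then show ?case using insert by simp
qed

lemma total_degree_le_det:
  fixes M :: "'a :: comm_ring_1 poly poly mat"
  assumes "M \<in> carrier_mat d d" "\<And>i j. i < d \<Longrightarrow> j < d \<Longrightarrow> total_degree_le 1 (M $$ (i, j))"
  shows "total_degree_le d (det M)"
  unfolding det_def'[OF assms(1)]
proof (rule total_degree_le_sum)
  fix \<sigma> assume "\<sigma> \<in> {\<sigma>. \<sigma> permutes {0..<d}}"
  then have \<sigma>: "\<sigma> i < d" if "i < d" for i using that permutes_in_image[of \<sigma> "{0..<d}" i] by auto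
  have "total_degree_le (card {0..<d}) (\<Prod>i = 0..<d. M $$ (i, \<sigma> i))"
    by (rule total_degree_le_prod) (use assms(2) \<sigma> in auto)
  then show "total_degree_le d (signof \<sigma> * (\<Prod>i = 0..<d. M $$ (i, \<sigma> i)))"
    by (cases "sign \<sigma> = 1") (auto simp: sign_def total_degree_le_def)
qed

lemma degree_le_if_total_degree_le: "total_degree_le m p \<Longrightarrow> degree p \<le> m"
  for p :: "'a :: comm_ring_1 poly poly"
  by (rule degree_le) (metis total_degree_le_def coeff_0 leading_coeff_0_iff not_less
        add.commute add_leD1 less_le_not_le)

lemma eval2_eq_sum_forms:
  assumes "total_degree_le N p"
  shows "eval2 p (x, y) = (\<Sum>k\<le>N. form_value k p x y)"
proof -
  have deg: "degree p \<le> N" by (rule degree_le_if_total_degree_le[OF assms])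
  have degc: "degree (coeff p j) \<le> N - j" for j
    by (rule degree_le) (use assms in \<open>fastforce simp: total_degree_le_def\<close>)
  have "eval2 p (x, y) = (\<Sum>j\<le>N. poly (coeff p j) x * y ^ j)"
    by (simp add: eval2_def poly_eq_sum_upto[OF deg] poly_sum)
  also have "\<dots> = (\<Sum>j\<le>N. \<Sum>i\<le>N - j. coeff (coeff p j) i * x ^ i * y ^ j)"
    by (simp add: poly_eq_sum_upto[OF degc] sum_distrib_right)
  also have "\<dots> = (\<Sum>(j, i)\<in>(SIGMA j:{..N}. {..N - j}). coeff (coeff p j) i * x ^ i * y ^ j)"
    by (simp add: sum.Sigma)
  also have "\<dots> = (\<Sum>(k, j)\<in>(SIGMA k:{..N}. {..k}). coeff (coeff p j) (k - j) * x ^ (k - j) * y ^ j)"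
    by (rule sum.reindex_bij_witness[of _ "\<lambda>(k, j). (j, k - j)" "\<lambda>(j, i). (i + j, j)"]) auto
  also have "\<dots> = (\<Sum>k\<le>N. form_value k p x y)"
    by (simp add: form_value_def sum.Sigma)
  finally show ?thesis .
qed

lemma form_value_scale: "form_value k p (l * a) (l * b) = l ^ k * form_value k p a b"
  unfolding form_value_def sum_distrib_left
  by (rule sum.cong) (auto simp: power_mult_distrib mult_ac simp flip: power_add)

lemma form_value_eq_0: "total_degree_le N p \<Longrightarrow> k > N \<Longrightarrow> form_value k p a b = 0"
  unfolding form_value_def total_degree_le_def by (intro sum.neutral ballI) (fastforce)

lemma form_value_1: "form_value k p 1 b = poly (homog_part k p) b"
  by (simp add: form_value_def poly_eq_sum_upto[OF degree_homog_part] coeff_homog_part)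

text \<open>
  The polynomial \<open>p(a s, b s)\<close> in \<open>s\<close>.  Its coefficients are the values at \<open>(a, b)\<close> of the homogeneous
  parts of \<open>p\<close>, and it is multiplicative in \<open>p\<close>, so that statements about top forms of products
  become statements about products of univariate polynomials.
\<close>

definition ray :: "complex \<Rightarrow> complex \<Rightarrow> poly2 \<Rightarrow> complex poly" where
  "ray a b p = (\<Sum>k\<le>total_degree p. monom (form_value k p a b) k)"

lemma coeff_ray: "coeff (ray a b p) k = form_value k p a b"
  unfolding ray_def coeff_sum coeff_monom
  by (simp add: sum.delta form_value_eq_0[OF total_degree_le_self])

lemma degree_ray: "degree (ray a b p) \<le> total_degree p"
  by (rule degree_le) (simp add: coeff_ray form_value_eq_0[OF total_degree_le_self])

lemma poly_ray: "poly (ray a b p) s = eval2 p (a * s, b * s)"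
  unfolding eval2_eq_sum_forms[OF total_degree_le_self] ray_def
  by (simp add: poly_sum poly_monom mult.commute[of _ s] form_value_scale) (simp add: mult.commute)

lemma ray_hom: "comm_ring_hom (ray a b)"
  by unfold_locales (simp_all add: poly_eq_poly_eq_iff[symmetric] fun_eq_iff poly_ray)

lemma ray_mult: "ray a b (p * q) = ray a b p * ray a b q"
  by (simp add: poly_eq_poly_eq_iff[symmetric] fun_eq_iff poly_ray)

text \<open>
  A line \<open>y = \<beta> x\<close> on which neither top form vanishes exists because both top forms are nonzero
  polynomials in \<open>\<beta>\<close>.
\<close>

lemma total_degree_mult_ge:
  assumes "p \<noteq> 0" "q \<noteq> 0"
  shows "total_degree p + total_degree q \<le> total_degree (p * q)"
proof -
  have nz: "homog_part (total_degree p) p \<noteq> 0" if "p \<noteq> 0" for p :: poly2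
  proof -
    obtain i j where "coeff (coeff p j) i \<noteq> 0" "i + j = total_degree p"
      using total_degree_attained[OF \<open>p \<noteq> 0\<close>] .
    then have "coeff (homog_part (total_degree p) p) j \<noteq> 0"
      by (metis coeff_homog_part add_diff_cancel_right' le_add2)
    then show ?thesis by auto
  qed
  let ?h = "homog_part (total_degree p) p * homog_part (total_degree q) q"
  have "?h \<noteq> 0" using nz assms by simp
  then obtain \<beta> where \<beta>: "poly ?h \<beta> \<noteq> 0" using poly_all_0_iff_0 by blast
  have "coeff (ray 1 \<beta> (p * q)) (total_degree p + total_degree q) = poly ?h \<beta>"
    unfolding ray_mult by (simp add: coeff_mult_at_bounds(1) degree_ray coeff_ray form_value_1)
  then have "form_value (total_degree p + total_degree q) (p * q) 1 \<beta> \<noteq> 0" using \<beta> by (simp add: coeff_ray)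
  then show ?thesis using form_value_eq_0[OF total_degree_le_self] not_le by blast
qed

text \<open>
  Restricted to the line through \<open>(a, b)\<close>, the polynomial \<open>G\<close> has degree \<open>d\<close>, which is at least the sum
  of the total degrees of \<open>q\<close> and its cofactor.  Hence both factors attain their total degrees on
  this line.
\<close>

lemma divisor_total_degree_and_form:
  assumes "q dvd G" "total_degree_le d G" "form_value d G a b \<noteq> 0"
  shows "total_degree q \<le> d" "form_value (total_degree q) q a b \<noteq> 0"
proof -
  obtain r where G: "G = q * r" using assms(1) by (elim dvdE)
  have "G \<noteq> 0" using assms(3) by (auto simp: form_value_def)
  then have "total_degree q + total_degree r \<le> d"
    using total_degree_mult_ge[of q r] assms(2) total_degree_le_iff[of G d] G by auto
  moreover have "degree (ray a b G) \<le> total_degree q + total_degree r"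
    unfolding G ray_mult using degree_mult_le[of "ray a b q" "ray a b r"] degree_ray[of a b q] degree_ray[of a b r]
    by linarith
  moreover have "d \<le> degree (ray a b G)" using assms(3) by (intro le_degree) (simp add: coeff_ray)
  ultimately have d: "d = total_degree q + total_degree r" by simp
  then show "total_degree q \<le> d" by simp
  have "form_value d G a b = form_value (total_degree q) q a b * form_value (total_degree r) r a b"
    using coeff_mult_at_bounds(1)[OF degree_ray degree_ray, of a b q a b r] d
    by (simp add: G coeff_ray flip: ray_mult)
  then show "form_value (total_degree q) q a b \<noteq> 0" using assms(3) by auto
qed

lemma coeff_homogenization_0:
  "coeff (coeff (poly (homogenization f) 0) j) i =
     (if i + j = total_degree f then coeff (coeff f j) i else 0)"
proof -
  let ?d = "total_degree f"
  have m3: "poly (mono3 c i j k) 0 = (if k = 0 then mono2 c i j else 0)" for c i j k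
    by (simp add: mono3_def poly_monom)
  have "poly (homogenization f) 0 = (\<Sum>j\<le>degree f. \<Sum>i\<le>degree (coeff f j).
      if i + j \<ge> ?d then mono2 (coeff (coeff f j) i) i j else 0)"
    unfolding homogenization_def poly_sum m3 by (intro sum.cong refl) auto
  also have "coeff (coeff \<dots> j) i = (\<Sum>j'\<le>degree f. \<Sum>i'\<le>degree (coeff f j').
      if i' = i \<and> j' = j \<and> i + j \<ge> ?d then coeff (coeff f j) i else 0)"
    unfolding coeff_sum by (intro sum.cong refl) (auto simp: mono2_def coeff_monom)
  also have "\<dots> = (\<Sum>j'\<le>degree f. if j' = j then (\<Sum>i'\<le>degree (coeff f j).
      if i' = i then (if i + j \<ge> ?d then coeff (coeff f j) i else 0) else 0) else 0)"
    by (intro sum.cong refl) (auto intro!: sum.cong)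
  also have "\<dots> = (if i + j \<ge> ?d then coeff (coeff f j) i else 0)"
    by (auto simp: sum.delta coeff_eq_0 not_le)
  also have "\<dots> = (if i + j = ?d then coeff (coeff f j) i else 0)"
    using total_degree_le_self[of f] by (fastforce simp: total_degree_le_def)
  finally show ?thesis .
qed

lemma eval3_homogenization_0: "eval3 (homogenization f) a b 0 = form_value (total_degree f) f a b"
proof -
  let ?F = "poly (homogenization f) 0"
  have le: "total_degree_le (total_degree f) ?F"
    unfolding total_degree_le_def by (simp add: coeff_homogenization_0)
  have "eval3 (homogenization f) a b 0 = (\<Sum>k\<le>total_degree f. form_value k ?F a b)"
    by (simp add: eval3_def eval2_eq_sum_forms[OF le])
  also have "\<dots> = (\<Sum>k\<le>total_degree f. if k = total_degree f then form_value k f a b else 0)"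
    by (intro sum.cong refl) (auto simp: form_value_def coeff_homogenization_0 intro!: sum.cong sum.neutral)
  finally show ?thesis by simp
qed

lemma points_at_infinity_eq:
  "points_at_infinity q = {proj_point a b 0 | a b. (a, b) \<noteq> (0, 0) \<and> form_value (total_degree q) q a b = 0}"
  unfolding points_at_infinity_def eval3_homogenization_0 ..

section \<open>Curves parametrized with a common denominator\<close>

text \<open>
  The curve parametrized by \<open>(n\<^sub>1 / b, n\<^sub>2 / b)\<close>.  Its degree and its points at infinity are found
  from the polynomials that vanish on it.  As the degree of \<open>b\<close> bounds those of the numerators,
  the point \<open>t = \<infinity>\<close> is not mapped to infinity.
\<close>

locale rational_curve =
  fixes n1 n2 b :: "complex poly" and d :: nat
  assumes degree_b: "degree b = d" and d_pos: "d > 0"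
    and degree_n1: "degree n1 \<le> d" and degree_n2: "degree n2 \<le> d"
    and no_common_root: "\<And>t. poly b t = 0 \<Longrightarrow> poly n1 t \<noteq> 0"
begin

definition curve_points :: "point set" where
  "curve_points = {(poly n1 t / poly b t, poly n2 t / poly b t) | t. poly b t \<noteq> 0}"

definition vanishes :: "poly2 \<Rightarrow> bool" where
  "vanishes p \<longleftrightarrow> (\<forall>P\<in>curve_points. eval2 p P = 0)"

lemma b_nonzero: "b \<noteq> 0" using degree_b d_pos by auto

text \<open>
  The polynomial \<open>g\<close> is \<open>b\<^sup>N p(n\<^sub>1 / b, n\<^sub>2 / b)\<close>, the homogenization of \<open>p\<close> evaluated at \<open>(n\<^sub>1 : n\<^sub>2 : b)\<close>.
\<close>

lemma pullback:
  assumes "total_degree_le N p"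
  obtains g where "\<And>t. poly b t \<noteq> 0 \<Longrightarrow> poly g t = poly b t ^ N * eval2 p (poly n1 t / poly b t, poly n2 t / poly b t)"
    and "\<And>t. poly b t = 0 \<Longrightarrow> poly g t = form_value N p (poly n1 t) (poly n2 t)"
proof
  define F where "F = (\<lambda>k. \<Sum>j\<le>k. Polynomial.smult (coeff (coeff p j) (k - j)) (n1 ^ (k - j) * n2 ^ j))"
  define g where "g = (\<Sum>k\<le>N. b ^ (N - k) * F k)"
  have F: "poly (F k) t = form_value k p (poly n1 t) (poly n2 t)" for k t
    by (simp add: F_def form_value_def poly_sum mult.assoc)
  fix t
  show "poly g t = poly b t ^ N * eval2 p (poly n1 t / poly b t, poly n2 t / poly b t)" if b: "poly b t \<noteq> 0"
  proof -
    have "form_value k p (poly n1 t) (poly n2 t) =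
        poly b t ^ k * form_value k p (poly n1 t / poly b t) (poly n2 t / poly b t)" for k
      using b by (simp flip: form_value_scale)
    then have "poly g t = (\<Sum>k\<le>N. poly b t ^ N * form_value k p (poly n1 t / poly b t) (poly n2 t / poly b t))"
      by (simp add: g_def poly_sum F flip: power_add mult.assoc)
    then show ?thesis by (simp add: eval2_eq_sum_forms[OF assms] sum_distrib_left)
  qed
  show "poly g t = form_value N p (poly n1 t) (poly n2 t)" if b: "poly b t = 0"
  proof -
    have "poly g t = (\<Sum>k\<le>N. if k = N then poly (F k) t else 0)"
      unfolding g_def poly_sum by (intro sum.cong refl) (auto simp: b)
    then show ?thesis by (simp add: F)
  qed
qed

lemma poly_eq_0_if_off_roots:
  assumes "\<And>t. poly b t \<noteq> 0 \<Longrightarrow> poly g t = 0"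
  shows "g = 0"
proof -
  have "poly (g * b) t = 0" for t using assms[of t] by auto
  then have "g * b = 0" using poly_all_0_iff_0 by blast
  then show ?thesis using b_nonzero by simp
qed

lemma vanishes_mult:
  assumes "vanishes (p * q)"
  shows "vanishes p \<or> vanishes q"
proof -
  obtain g where g: "\<And>t. poly b t \<noteq> 0 \<Longrightarrow> poly g t =
      poly b t ^ total_degree p * eval2 p (poly n1 t / poly b t, poly n2 t / poly b t)"
    using pullback[OF total_degree_le_self] by metis
  obtain h where h: "\<And>t. poly b t \<noteq> 0 \<Longrightarrow> poly h t =
      poly b t ^ total_degree q * eval2 q (poly n1 t / poly b t, poly n2 t / poly b t)"
    using pullback[OF total_degree_le_self] by metis
  have "poly (g * h) t = 0" if "poly b t \<noteq> 0" for t
  proof -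
    have "(poly n1 t / poly b t, poly n2 t / poly b t) \<in> curve_points" using that unfolding curve_points_def by blast
    then have "eval2 p (poly n1 t / poly b t, poly n2 t / poly b t) *
        eval2 q (poly n1 t / poly b t, poly n2 t / poly b t) = 0"
      using assms by (simp add: vanishes_def flip: eval2_mult)
    then show ?thesis using g[OF that] h[OF that] by auto
  qed
  then have "g * h = 0" by (rule poly_eq_0_if_off_roots)
  then have "g = 0 \<or> h = 0" by simp
  then show ?thesis using g h unfolding vanishes_def curve_points_def by fastforce
qed

lemma curve_points_nonempty: "\<exists>P. P \<in> curve_points"
proof -
  obtain t where "poly b t \<noteq> 0" using b_nonzero poly_all_0_iff_0 by blast
  then show ?thesis unfolding curve_points_def by blast
qed

text \<open>
  The first coordinate is not constant: \<open>n\<^sub>1 = c b\<close> is impossible at a zero of \<open>b\<close>.  Therefore it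
  takes infinitely many values, and no nonzero polynomial in \<open>x\<close> alone vanishes on the curve.
\<close>

lemma vanishes_const: "vanishes [:r:] \<Longrightarrow> r = 0"
proof (rule ccontr)
  assume v: "vanishes [:r:]" and r: "r \<noteq> 0"
  have "poly b t \<noteq> 0 \<Longrightarrow> poly r (poly n1 t / poly b t) = 0" for t
    using v unfolding vanishes_def curve_points_def eval2_def by fastforce
  \<comment> \<open>Every \<open>t\<close> is a zero of \<open>b\<close> or of \<open>n\<^sub>1 - c b\<close> for one of the finitely many roots \<open>c\<close> of \<open>r\<close>.\<close>
  then have "UNIV \<subseteq> {t. poly b t = 0} \<union> (\<Union>c\<in>{c. poly r c = 0}. {t. poly (n1 - Polynomial.smult c b) t = 0})"
  proof (intro subsetI)
    fix t assume *: "poly b t \<noteq> 0 \<Longrightarrow> poly r (poly n1 t / poly b t) = 0" for t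
    show "t \<in> {t. poly b t = 0} \<union> (\<Union>c\<in>{c. poly r c = 0}. {t. poly (n1 - Polynomial.smult c b) t = 0})"
    proof (cases "poly b t = 0")
      case False
      then show ?thesis using *[OF False] by (auto intro!: exI[of _ "poly n1 t / poly b t"])
    qed simp
  qed
  moreover have "n1 - Polynomial.smult c b \<noteq> 0" for c
  proof
    assume eq: "n1 - Polynomial.smult c b = 0"
    obtain t where t: "poly b t = 0"
      using fundamental_theorem_of_algebra[of b] degree_b d_pos by (auto simp: constant_degree)
    have "poly (n1 - Polynomial.smult c b) t = poly n1 t" using t by simp
    then show False using no_common_root[OF t] by (simp add: eq)
  qed
  then have fin: "finite {t. poly (n1 - Polynomial.smult c b) t = 0}" for c by (rule poly_roots_finite)
  have "finite ({t. poly b t = 0} \<union> (\<Union>c\<in>{c. poly r c = 0}. {t. poly (n1 - Polynomial.smult c b) t = 0}))"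
    by (intro finite_UnI finite_UN_I poly_roots_finite[OF r] poly_roots_finite[OF b_nonzero] fin)
  ultimately have "finite (UNIV :: complex set)" by (rule finite_subset)
  then show False using infinite_UNIV_char_0 by blast
qed

text \<open>
  Otherwise \<open>q\<close> and \<open>p\<close> are coprime, and their resultant with respect to \<open>y\<close> is a nonzero polynomial
  in \<open>x\<close> that vanishes on the curve.
\<close>

lemma vanishing_divisible:
  assumes q: "irreducible q" "vanishes q" and p: "vanishes p"
  shows "q dvd p"
proof (rule ccontr)
  assume "\<not> q dvd p"
  then have "coprime q p" using q(1) irreducible_imp_prime_elem prime_elem_imp_coprime by blast
  then have "degree (gcd q p) = 0" by simp
  then have nz: "resultant q p \<noteq> 0" by (simp add: resultant_0_gcd)
  \<comment> \<open>The resultant of two constants in \<open>y\<close> would be \<open>1\<close>.\<close>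
  have deg: "degree q + degree p > 0"
  proof (rule ccontr)
    assume "\<not> ?thesis"
    then have "q = [:coeff q 0:]" by (metis degree_0_id gr0I add_is_0)
    then obtain c where c: "q = [:c:]" by blast
    then have "c = 0" using q(2) vanishes_const by blast
    then show False using q(1) c by simp
  qed
  have "vanishes [:resultant q p:]"
    unfolding vanishes_def
  proof
    fix P assume P: "P \<in> curve_points"
    obtain x y where xy: "P = (x, y)" by force
    have ev: "poly (map_poly (\<lambda>c. poly c x) s) y = eval2 s P" for s
    proof -
      have "eval2 s P = (\<Sum>j\<le>degree s. poly (coeff s j) x * y ^ j)"
        by (simp add: eval2_def xy poly_altdef[of s] poly_sum)
      also have "\<dots> = poly (map_poly (\<lambda>c. poly c x) s) y"
        by (subst poly_eq_sum_upto[OF degree_map_poly_le]) (simp add: coeff_map_poly)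
      finally show ?thesis by simp
    qed
    have "poly (resultant q p) x = 0"
      unfolding resultant_sub poly_resultant_sub
      by (rule resultant_sub_eq_0_if_common_root[of _ _ _ _ y])
        (use P q p deg in \<open>auto simp: ev degree_map_poly_le vanishes_def\<close>)
    then show "eval2 [:resultant q p:] P = 0" by (simp add: eval2_def xy)
  qed
  then show False using vanishes_const nz by blast
qed

text \<open>
  The polynomials that vanish on the curve form a proper prime ideal, so some prime factor of \<open>G\<close>
  belongs to it.
\<close>

lemma irreducible_factor_vanishes:
  assumes "G \<noteq> 0" "vanishes G"
  obtains q where "irreducible q" "vanishes q"
proof -
  have unit: "\<not> vanishes u" if "is_unit u" for u
  proof
    assume u: "vanishes u"
    obtain v where v: "1 = u * v" using \<open>is_unit u\<close> by (elim dvdE)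
    obtain P where "P \<in> curve_points" using curve_points_nonempty by blast
    then have "eval2 (u * v) P = 0" using u by (simp add: vanishes_def)
    then show False by (simp flip: v)
  qed
  have "\<exists>q. prime_elem q \<and> vanishes q" if "vanishes G" "G = u * prod_mset A" "is_unit u" "\<forall>q\<in>#A. prime_elem q" for u A
    using that
  proof (induction A arbitrary: G)
    case empty
    then show ?case using unit by auto
  next
    case (add q A)
    then have "vanishes (q * (u * prod_mset A))" by (simp add: mult_ac)
    then show ?case using vanishes_mult[of q "u * prod_mset A"] add by auto
  qed
  moreover obtain A where A: "\<forall>q\<in>#A. prime_elem q" "normalize (prod_mset A) = normalize G"
    using prime_factorization_exists[OF assms(1)] by (metis prime_elem_def prime_imp_prime_elem)
  moreover obtain u where "is_unit u" "G = u * prod_mset A"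
    using A(2) by (metis associatedE1 mult.commute)
  ultimately show ?thesis using assms(2) that prime_elem_imp_irreducible by blast
qed

lemma coprime_if_no_common_root:
  assumes "\<And>t. poly b t = 0 \<Longrightarrow> poly l t \<noteq> 0"
  shows "coprime l b"
proof -
  have "degree (gcd l b) = 0"
  proof (rule ccontr)
    assume "degree (gcd l b) \<noteq> 0"
    then obtain t where "poly (gcd l b) t = 0"
      using fundamental_theorem_of_algebra[of "gcd l b"] by (auto simp: constant_degree)
    then have "poly l t = 0" "poly b t = 0" by (meson dvd_trans gcd_dvd1 gcd_dvd2 poly_eq_0_iff_dvd)+
    then show False using assms by blast
  qed
  moreover have "gcd l b \<noteq> 0" using b_nonzero by simp
  ultimately have "is_unit (gcd l b)" using is_unit_iff_degree by blast
  then show ?thesis unfolding is_unit_gcd .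
qed

text \<open>
  The pairs \<open>(r, s)\<close> of polynomials of degree less than \<open>d\<close> represent every \<open>h\<close> of degree less than \<open>2 d\<close>:
  \<open>s\<close> is determined modulo \<open>b\<close>, and reducing it forces the degree of \<open>r\<close> down as well, because \<open>b\<close> has
  degree exactly \<open>d\<close>.
\<close>

lemma bezout_degrees:
  assumes "coprime l b" "degree l \<le> d" "degree h < 2 * d"
  obtains r s where "h = b * r + l * s" "degree r < d" "degree s < d"
proof -
  obtain u v where uv: "u * l + v * b = 1"
    using bezout_coefficients_fst_snd[of l b] assms(1) by (metis coprime_iff_gcd_eq_1)
  define s where "s = (h * u) mod b"
  have s: "degree s < d" unfolding s_def
    using degree_mod_less'[of b "h * u"] b_nonzero degree_b d_pos by (cases "(h * u) mod b = 0") auto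
  have "h - l * s = h * (u * l + v * b) - l * s" by (simp add: uv)
  also have "\<dots> = l * (h * u - s) + b * (h * v)" by (simp add: algebra_simps)
  finally have "b dvd h - l * s"
    by (metis s_def dvd_add dvd_minus_mod dvd_mult dvd_triv_left)
  then obtain r where r: "h - l * s = b * r" by (elim dvdE)
  have "degree r < d"
  proof (cases "r = 0")
    case False
    have "degree (l * s) < 2 * d" using degree_mult_le[of l s] assms(2) s by linarith
    then have "degree (b * r) < 2 * d" unfolding r[symmetric] using assms(3) by (intro degree_diff_less) auto
    then show ?thesis using False b_nonzero degree_b by (simp add: degree_mult_eq)
  qed (use d_pos in simp)
  moreover have "h = b * r + l * s" using r by (simp add: algebra_simps)
  ultimately show ?thesis using that s by blast
qed

text \<open>
  Put \<open>u = (\<beta> n\<^sub>1 - \<alpha> n\<^sub>2) / b = l / b\<close>, and let \<open>w = h / b\<close> be a second linear form in the coordinates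
  that takes the value \<open>1\<close> at \<open>(\<alpha>, \<beta>)\<close>.  By assumption \<open>l\<close> and \<open>b\<close> are coprime, so for \<open>k < d\<close>
  there are \<open>r\<^sub>k, s\<^sub>k\<close> of degree less than \<open>d\<close> with \<open>h t\<^sup>k = b r\<^sub>k + l s\<^sub>k\<close>, that is,
  \<open>w t\<^sup>k = r\<^sub>k(t) + u s\<^sub>k(t)\<close>.  In terms of the matrices \<open>R\<close> and \<open>T\<close> of coefficients of the \<open>r\<^sub>k\<close> and \<open>s\<^sub>k\<close>,
  the matrix \<open>w I - R - u T\<close> kills the vector \<open>(1, t, \<dots>, t\<^bsup>d-1\<^esup>)\<close>, and its determinant \<open>G\<close> vanishes on
  the curve.  The entries are of degree at most \<open>1\<close> in the coordinates, and their linear parts at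
  \<open>(\<alpha>, \<beta>)\<close>, where \<open>u = 0\<close> and \<open>w = 1\<close>, form the identity matrix.
\<close>

lemma vanishing_polynomial:
  assumes dir: "\<And>t. poly b t = 0 \<Longrightarrow> \<beta> * poly n1 t \<noteq> \<alpha> * poly n2 t"
  obtains G where "vanishes G" "total_degree_le d G" "form_value d G \<alpha> \<beta> \<noteq> 0"
proof -
  have nz: "\<alpha> \<noteq> 0 \<or> \<beta> \<noteq> 0"
  proof -
    obtain t where t: "poly b t = 0"
      using fundamental_theorem_of_algebra[of b] degree_b d_pos by (auto simp: constant_degree)
    show ?thesis using dir[OF t] by auto
  qed
  then obtain \<gamma> \<delta> where \<gamma>\<delta>: "\<gamma> * \<alpha> + \<delta> * \<beta> = 1"
  proof (cases "\<alpha> = 0")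
    case True
    then show ?thesis using nz that[of 0 "1 / \<beta>"] by simp
  next
    case False
    then show ?thesis using that[of "1 / \<alpha>" 0] by simp
  qed
  define l where "l = Polynomial.smult \<beta> n1 - Polynomial.smult \<alpha> n2"
  define h where "h = Polynomial.smult \<gamma> n1 + Polynomial.smult \<delta> n2"
  have deg: "degree l \<le> d" "degree h \<le> d"
    unfolding l_def h_def using degree_n1 degree_n2
    by (auto intro!: degree_diff_le degree_add_le intro: order_trans[OF degree_smult_le])
  have cop: "coprime l b" by (rule coprime_if_no_common_root) (use dir in \<open>simp add: l_def\<close>)
  have "\<exists>r s. h * monom 1 k = b * r + l * s \<and> degree r < d \<and> degree s < d" if "k < d" for k
  proof -
    have "degree (h * monom 1 k) < 2 * d"
      using degree_mult_le[of h "monom 1 k"] deg(2) that by (simp add: degree_monom_eq)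
    then show ?thesis using bezout_degrees[OF cop deg(1)] by metis
  qed
  then obtain r s where rs: "\<And>k. k < d \<Longrightarrow> h * monom 1 k = b * r k + l * s k"
    and degr: "\<And>k. k < d \<Longrightarrow> degree (r k) < d" and degs: "\<And>k. k < d \<Longrightarrow> degree (s k) < d"
    by metis
  define U where "U = mono2 \<beta> 1 0 - mono2 \<alpha> 0 1"
  define W where "W = mono2 \<gamma> 1 0 + mono2 \<delta> 0 1"
  define M where "M = mat d d (\<lambda>(k, j). (if k = j then W else 0) - [:[:coeff (r k) j:]:] - [:[:coeff (s k) j:]:] * U)"
  define G where "G = det M"
  have M: "M \<in> carrier_mat d d" by (simp add: M_def)
  have "total_degree_le d G"
    unfolding G_def
  proof (rule total_degree_le_det[OF M])
    fix k j assume "k < d" "j < d"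
    then show "total_degree_le 1 (M $$ (k, j))"
      by (auto simp: M_def U_def W_def total_degree_le_def mono2_def coeff_monom coeff_pCons split: nat.splits if_splits)
  qed
  moreover have "form_value d G \<alpha> \<beta> \<noteq> 0"
  proof -
    let ?R = "map_mat (ray \<alpha> \<beta>) M"
    have entry: "coeff (ray \<alpha> \<beta> (M $$ (k, j))) 1 = (if k = j then 1 else 0)"
      and degree: "degree (ray \<alpha> \<beta> (M $$ (k, j))) \<le> 1" if "k < d" "j < d" for k j
    proof -
      have U: "eval2 U (\<alpha> * x, \<beta> * x) = 0" for x by (simp add: U_def)
      have "eval2 W (\<alpha> * x, \<beta> * x) = (\<gamma> * \<alpha> + \<delta> * \<beta>) * x" for x
        by (simp add: W_def algebra_simps)
      then have W: "eval2 W (\<alpha> * x, \<beta> * x) = x" for x by (simp add: \<gamma>\<delta>)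
      have "poly (ray \<alpha> \<beta> (M $$ (k, j))) x = poly [:- coeff (r k) j, if k = j then 1 else 0:] x" for x
        using that by (simp add: poly_ray M_def U W)
      then have "ray \<alpha> \<beta> (M $$ (k, j)) = [:- coeff (r k) j, if k = j then 1 else 0:]"
        by (simp add: poly_eq_poly_eq_iff[symmetric] fun_eq_iff)
      then show "coeff (ray \<alpha> \<beta> (M $$ (k, j))) 1 = (if k = j then 1 else 0)"
        "degree (ray \<alpha> \<beta> (M $$ (k, j))) \<le> 1" by auto
    qed
    have R: "?R \<in> carrier_mat d d" using M by simp
    have degR: "\<forall>k<d. \<forall>j<d. degree (?R $$ (k, j)) \<le> 1" using degree M by auto
    have "coeff (det ?R) d = det (mat d d (\<lambda>(k, j). coeff (?R $$ (k, j)) 1))"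
      by (rule det_weighted(2)[OF R, where e = "\<lambda>_ _. 1"]) (use degR in auto)
    also have "mat d d (\<lambda>(k, j). coeff (?R $$ (k, j)) 1) = 1\<^sub>m d"
      using M entry by (intro eq_matI) auto
    finally have "coeff (det ?R) d = 1" by simp
    then have "coeff (ray \<alpha> \<beta> G) d = 1"
      by (simp add: G_def comm_ring_hom.hom_det[OF ray_hom])
    then show ?thesis by (simp add: coeff_ray)
  qed
  moreover have "vanishes G"
    unfolding vanishes_def
  proof
    fix P assume "P \<in> curve_points"
    then obtain t where t: "poly b t \<noteq> 0" and P: "P = (poly n1 t / poly b t, poly n2 t / poly b t)"
      unfolding curve_points_def by blast
    let ?M = "map_mat (\<lambda>p. eval2 p P) M" and ?v = "vec d (\<lambda>j. t ^ j)"
    have "?v \<noteq> 0\<^sub>v d"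
    proof
      assume "?v = 0\<^sub>v d"
      from arg_cong[OF this, of "\<lambda>u. vec_index u 0"] d_pos show False by simp
    qed
    moreover have "?M *\<^sub>v ?v = 0\<^sub>v d"
    proof (rule eq_vecI)
      fix k assume "k < dim_vec (0\<^sub>v d :: complex vec)"
      then have k: "k < d" by simp
      have U: "eval2 U P = poly l t / poly b t" and W: "eval2 W P = poly h t / poly b t"
        by (simp_all add: U_def W_def P l_def h_def diff_divide_distrib add_divide_distrib)
      have pr: "poly p t = (\<Sum>j<d. coeff p j * t ^ j)" if "degree p < d" for p
        using poly_eq_sum_upto[of p "d - 1" t] that d_pos by (simp add: lessThan_Suc_atMost[symmetric])
      have "vec_index (?M *\<^sub>v ?v) k = (\<Sum>j<d. eval2 (M $$ (k, j)) P * t ^ j)"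
        using k M by (simp add: scalar_prod_def atLeast0LessThan)
      also have "\<dots> = (\<Sum>j<d. (if k = j then eval2 W P * t ^ j else 0) - coeff (r k) j * t ^ j
            - eval2 U P * (coeff (s k) j * t ^ j))"
        using k by (intro sum.cong refl) (auto simp: M_def algebra_simps)
      also have "\<dots> = eval2 W P * t ^ k - poly (r k) t - eval2 U P * poly (s k) t"
        using k by (simp add: sum_subtractf pr degr degs sum_distrib_left)
      also have "\<dots> = (poly (h * monom 1 k) t - poly (b * r k + l * s k) t) / poly b t"
        using t by (simp add: U W poly_monom field_simps)
      also have "\<dots> = 0" by (simp add: rs[OF k])
      finally show "vec_index (?M *\<^sub>v ?v) k = vec_index (0\<^sub>v d) k" using k by simp
    qed (use M in simp)
    ultimately have "det ?M = 0"
      by (subst det_0_iff_vec_prod_zero[of _ d]) (use M in \<open>auto intro!: exI[of _ ?v]\<close>)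
    then show "eval2 G P = 0" by (simp add: G_def comm_ring_hom.hom_det[OF eval2_hom])
  qed
  ultimately show ?thesis using that by blast
qed

lemma irreducible_exists: obtains q where "irreducible q" "vanishes q"
proof -
  have "1 * poly n1 t \<noteq> 0 * poly n2 t" if "poly b t = 0" for t
    using no_common_root[OF that] by simp
  then obtain G where G: "vanishes G" "form_value d G 0 1 \<noteq> 0" using vanishing_polynomial by blast
  then have "G \<noteq> 0" by (auto simp: form_value_def)
  then show ?thesis using irreducible_factor_vanishes G(1) that by blast
qed

lemma zero_set_eq_closure:
  assumes "irreducible q" "vanishes q"
  shows "zero_set q = zariski_closure curve_points"
proof
  show "zero_set q \<subseteq> zariski_closure curve_points"
  proof
    fix P assume P: "P \<in> zero_set q"
    have "eval2 p P = 0" if "vanishes p" for p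
      using vanishing_divisible[OF assms that] P by (auto simp: zero_set_def elim!: dvdE)
    then show "P \<in> zariski_closure curve_points" by (auto simp: zariski_closure_def vanishes_def)
  qed
  show "zariski_closure curve_points \<subseteq> zero_set q"
    using assms(2) by (auto simp: zero_set_def zariski_closure_def vanishes_def)
qed

lemma vanishes_if_zero_set_eq_closure:
  assumes "zero_set q = zariski_closure curve_points"
  shows "vanishes q"
proof -
  have "curve_points \<subseteq> zariski_closure curve_points" by (auto simp: zariski_closure_def)
  then show ?thesis using assms by (auto simp: vanishes_def zero_set_def)
qed

lemma total_degree_le_d:
  assumes "irreducible q" "vanishes q"
  shows "total_degree q \<le> d"
proof -
  have "1 * poly n1 t \<noteq> 0 * poly n2 t" if "poly b t = 0" for t
    using no_common_root[OF that] by simp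
  then obtain G where G: "vanishes G" "total_degree_le d G" "form_value d G 0 1 \<noteq> 0" using vanishing_polynomial by blast
  then show ?thesis using divisor_total_degree_and_form(1) vanishing_divisible[OF assms] by blast
qed

text \<open>
  The points at infinity of the curve are the images of the zeros of \<open>b\<close>.  That these images lie on
  the curve is seen from \<open>b\<^sup>e q(n\<^sub>1 / b, n\<^sub>2 / b) = 0\<close>, where only the top form survives at a zero of \<open>b\<close>;
  that there are no others is \<open>vanishing_polynomial\<close>.
\<close>

lemma form_value_eq_0_iff:
  assumes "irreducible q" "vanishes q" "(\<alpha>, \<beta>) \<noteq> (0, 0)"
  shows "form_value (total_degree q) q \<alpha> \<beta> = 0 \<longleftrightarrow> (\<exists>t. poly b t = 0 \<and> \<beta> * poly n1 t = \<alpha> * poly n2 t)"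
proof
  assume 0: "form_value (total_degree q) q \<alpha> \<beta> = 0"
  show "\<exists>t. poly b t = 0 \<and> \<beta> * poly n1 t = \<alpha> * poly n2 t"
  proof (rule ccontr)
    assume "\<not> ?thesis"
    then have "\<And>t. poly b t = 0 \<Longrightarrow> \<beta> * poly n1 t \<noteq> \<alpha> * poly n2 t" by blast
    then obtain G where G: "vanishes G" "total_degree_le d G" "form_value d G \<alpha> \<beta> \<noteq> 0"
      using vanishing_polynomial by blast
    then show False using divisor_total_degree_and_form(2) vanishing_divisible[OF assms(1,2)] 0 by blast
  qed
next
  assume "\<exists>t. poly b t = 0 \<and> \<beta> * poly n1 t = \<alpha> * poly n2 t"
  then obtain t where t: "poly b t = 0" and dir: "\<beta> * poly n1 t = \<alpha> * poly n2 t" by blast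
  obtain g where g: "\<And>t. poly b t \<noteq> 0 \<Longrightarrow> poly g t =
      poly b t ^ total_degree q * eval2 q (poly n1 t / poly b t, poly n2 t / poly b t)"
    and g0: "\<And>t. poly b t = 0 \<Longrightarrow> poly g t = form_value (total_degree q) q (poly n1 t) (poly n2 t)"
    using pullback[OF total_degree_le_self] by metis
  have "g = 0"
    by (rule poly_eq_0_if_off_roots) (use g assms(2) in \<open>auto simp: vanishes_def curve_points_def\<close>)
  then have *: "form_value (total_degree q) q (poly n1 t) (poly n2 t) = 0" using g0[OF t] by simp
  have n1: "poly n1 t \<noteq> 0" using no_common_root[OF t] .
  then have \<alpha>: "\<alpha> \<noteq> 0" using dir assms(3) by auto
  define c where "c = poly n1 t / \<alpha>"
  have c: "c \<noteq> 0" "poly n1 t = c * \<alpha>" "poly n2 t = c * \<beta>"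
    using n1 \<alpha> dir by (auto simp: c_def field_simps)
  from * show "form_value (total_degree q) q \<alpha> \<beta> = 0"
    unfolding c(2,3) form_value_scale using c(1) by simp
qed

end

section \<open>The two resultants of a pencil and a curve\<close>

definition pencil_poly :: "poly2 \<Rightarrow> poly2 \<Rightarrow> complex poly poly poly" where
  "pencil_poly h1 h2 = lift_t h1 + Polynomial.smult [:[:0, 1:]:] (lift_t h2)"

lemma coeff_lift_t: "coeff (coeff (lift_t f) j) i = [:coeff (coeff f j) i:]"
  by (simp add: lift_t_def coeff_map_poly)

lemma coeff_pencil_poly: "coeff (coeff (pencil_poly h1 h2) j) i = [:coeff (coeff h1 j) i, coeff (coeff h2 j) i:]"
  by (simp add: pencil_poly_def coeff_lift_t)

lemma total_degree_le_lift_t: "total_degree_le n f \<Longrightarrow> total_degree_le n (lift_t f)"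
  by (auto simp: total_degree_le_def coeff_lift_t)

lemma total_degree_le_pencil_poly:
  "total_degree_le m h1 \<Longrightarrow> total_degree_le m h2 \<Longrightarrow> total_degree_le m (pencil_poly h1 h2)"
  unfolding total_degree_le_def coeff_pencil_poly by (metis pCons_0_0)

lemma pencil_resultant_padded:
  assumes h: "total_degree_le m h1" "total_degree_le m h2"
    and f: "total_degree_le n f" "coeff (coeff f n) 0 \<noteq> 0"
  obtains c where "c \<noteq> 0"
    "resultant_sub m n (pencil_poly h1 h2) (lift_t f) = Polynomial.smult [:c:] (pencil_resultant h1 h2 f)"
proof -
  let ?q = "lift_t f" and ?p = "pencil_poly h1 h2" and ?a = "coeff (coeff f n) 0"
  \<comment> \<open>The coefficient of \<open>y\<^sup>n\<close> in \<open>f\<close> is a constant, because the total degree is bounded by \<open>n\<close>.\<close>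
  have lead: "coeff ?q n = [:[:?a:]:]"
  proof (rule poly_eqI)
    fix i show "coeff (coeff ?q n) i = coeff [:[:?a:]:] i"
      using f(1) by (cases i) (fastforce simp: coeff_lift_t total_degree_le_def)+
  qed
  have deg: "degree ?q = n"
    using degree_le_if_total_degree_le[OF total_degree_le_lift_t[OF f(1)]] lead f(2)
    by (intro antisym le_degree) auto
  define k where "k = m - degree ?p"
  have const: "((-1) ^ n * [:[:?a:]:]) ^ k = [:[:((-1) ^ n * ?a) ^ k:]:]"
  proof -
    have hom: "[:[:x * y:]:] = [:[:x:]:] * [:[:y:]:]" for x y :: complex by simp
    have pow: "[:[:x ^ i:]:] = [:[:x:]:] ^ i" for x :: complex and i
      by (induction i) (simp_all add: hom flip: pCons_one)
    have "[:[:-1:]:] = - [:[:1 :: complex:]:]" by (simp only: minus_pCons minus_zero)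
    then have one: "[:[:-1:]:] = (-1 :: complex poly poly)" by (simp only: pCons_one)
    show ?thesis by (simp only: pow hom one)
  qed
  have "resultant_sub m n ?p ?q = ((-1) ^ n * [:[:?a:]:]) ^ k * resultant ?p ?q"
    using resultant_sub_pad[of ?p m ?q] degree_le_if_total_degree_le[OF total_degree_le_pencil_poly[OF h]]
    unfolding deg lead k_def by blast
  then have "resultant_sub m n ?p ?q = Polynomial.smult [:((-1) ^ n * ?a) ^ k:] (pencil_resultant h1 h2 f)"
    unfolding const by (simp add: pencil_resultant_def pencil_poly_def)
  then show ?thesis using that[of "((-1) ^ n * ?a) ^ k"] f(2) by simp
qed

lemma coeff_swap_vars: "coeff (coeff (swap_vars f) j) i = coeff (coeff f i) j"
proof -
  have "coeff (coeff (swap_vars f) j) i = (\<Sum>j'\<le>degree f. \<Sum>i'\<le>degree (coeff f j').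
      if i' = j \<and> j' = i then coeff (coeff f i) j else 0)"
    unfolding swap_vars_def coeff_sum by (intro sum.cong refl) (auto simp: mono2_def coeff_monom)
  also have "\<dots> = (\<Sum>j'\<le>degree f. if j' = i then (\<Sum>i'\<le>degree (coeff f i).
      if i' = j then coeff (coeff f i) j else 0) else 0)"
    by (intro sum.cong refl) (auto intro!: sum.cong)
  also have "\<dots> = coeff (coeff f i) j"
    by (auto simp: sum.delta coeff_eq_0 not_le)
  finally show ?thesis .
qed

lemma total_degree_le_swap_vars: "total_degree_le n f \<Longrightarrow> total_degree_le n (swap_vars f)"
  unfolding total_degree_le_def coeff_swap_vars by (metis add.commute)

lemma swap_vars_pencil:
  "coeff (coeff (pencil_poly (swap_vars h1) (swap_vars h2)) j) i = coeff (coeff (pencil_poly h1 h2) i) j"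
  "coeff (coeff (lift_t (swap_vars f)) j) i = coeff (coeff (lift_t f) i) j"
  by (simp_all add: coeff_pencil_poly coeff_lift_t coeff_swap_vars)

lemma poly_sylvester:
  assumes "i < m + n" "j < m + n"
  shows "poly (sylvester_mat_sub m n P Q $$ (i, j)) t =
    sylvester_mat_sub m n (map_poly (\<lambda>c. poly c t) P) (map_poly (\<lambda>c. poly c t) Q) $$ (i, j)"
  using assms by (simp add: sylvester_mat_sub_index coeff_map_poly)

text \<open>
  A pencil \<open>h\<^sub>1 + t h\<^sub>2\<close> of curves of degree at most \<open>m\<close> and a curve \<open>f = 0\<close> of degree \<open>n\<close> that
  avoids \<open>(1 : 0 : 0)\<close> and \<open>(0 : 1 : 0)\<close> and has no point at infinity in common with \<open>h\<^sub>2 = 0\<close>.  The three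
  polynomials defined below are, up to nonzero constants, the two highest coefficients of the
  resultants with respect to \<open>y\<close> and \<open>x\<close>.
\<close>

locale curve_pencil =
  fixes h1 h2 f :: poly2 and m n :: nat
  assumes m_pos: "m > 0" and n_pos: "n > 0"
    and h1_degree: "total_degree_le m h1" and h2_degree: "total_degree_le m h2"
    and f_degree: "total_degree_le n f"
    and y_power: "coeff (coeff f n) 0 \<noteq> 0" and x_power: "coeff (coeff f 0) n \<noteq> 0"
    and no_base_point: "\<And>\<beta>. poly (homog_part n f) \<beta> = 0 \<Longrightarrow> poly (homog_part m h2) \<beta> \<noteq> 0"
begin

abbreviation P :: "nat \<Rightarrow> complex poly poly" where "P k \<equiv> homog_part k (pencil_poly h1 h2)"
abbreviation Q :: "nat \<Rightarrow> complex poly poly" where "Q k \<equiv> homog_part k (lift_t f)"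

abbreviation syl :: "complex poly poly \<Rightarrow> complex poly poly \<Rightarrow> nat \<Rightarrow> nat \<Rightarrow> complex poly" where
  "syl U V \<equiv> (\<lambda>i j. sylvester_mat_sub m n U V $$ (i, j))"

definition lead :: "complex poly" where
  "lead = resultant_sub m n (P m) (Q n)"

definition sub_x :: "complex poly" where
  "sub_x = det_variation (m + n) (syl (P m) (Q n)) (syl (P (m - 1)) (Q (n - 1)))"

definition sub_y :: "complex poly" where
  "sub_y = det_variation (m + n) (syl (P m) (Q n)) (syl (pCons 0 (P (m - 1))) (pCons 0 (Q (n - 1))))"

lemma x_resultant:
  obtains c where "c \<noteq> 0" "degree (pencil_resultant h1 h2 f) \<le> m * n"
    "Polynomial.smult c (coeff (pencil_resultant h1 h2 f) (m * n)) = lead"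
    "Polynomial.smult c (coeff (pCons 0 (pencil_resultant h1 h2 f)) (m * n)) = sub_x"
proof -
  let ?R = "pencil_resultant h1 h2 f"
  obtain c where c: "c \<noteq> 0"
    and R: "resultant_sub m n (pencil_poly h1 h2) (lift_t f) = Polynomial.smult [:c:] ?R"
    using pencil_resultant_padded[OF h1_degree h2_degree f_degree y_power] .
  note top = resultant_sub_top_coeffs[OF total_degree_le_pencil_poly[OF h1_degree h2_degree]
      total_degree_le_lift_t[OF f_degree] m_pos n_pos, unfolded R]
  have "Polynomial.smult c (coeff (pCons 0 ?R) (m * n)) = coeff (pCons 0 (Polynomial.smult [:c:] ?R)) (m * n)"
    by (cases "m * n") auto
  then show ?thesis
    using that[OF c] top c unfolding lead_def sub_x_def by simp
qed

text \<open>
  After the exchange of variables the top forms have their coefficients reversed.  In the forms of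
  the next lower degree \<open>k - 1\<close>, the reversal with respect to \<open>k\<close> introduces a factor \<open>y\<close>; this is the
  only difference between the coefficients \<open>sub_x\<close> and \<open>sub_y\<close>.
\<close>

lemma y_resultant:
  obtains c where "c \<noteq> 0" "degree (pencil_resultant (swap_vars h1) (swap_vars h2) (swap_vars f)) \<le> m * n"
    "Polynomial.smult c (coeff (pencil_resultant (swap_vars h1) (swap_vars h2) (swap_vars f)) (m * n)) = lead"
    "Polynomial.smult c (coeff (pCons 0 (pencil_resultant (swap_vars h1) (swap_vars h2) (swap_vars f))) (m * n)) = sub_y"
proof -
  let ?R = "pencil_resultant (swap_vars h1) (swap_vars h2) (swap_vars f)"
  let ?p = "pencil_poly (swap_vars h1) (swap_vars h2)" and ?q = "lift_t (swap_vars f)"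
  note deg = h1_degree[THEN total_degree_le_swap_vars] h2_degree[THEN total_degree_le_swap_vars]
    f_degree[THEN total_degree_le_swap_vars]
  obtain c where c: "c \<noteq> 0" and R: "resultant_sub m n ?p ?q = Polynomial.smult [:c:] ?R"
    using pencil_resultant_padded[OF deg] x_power by (auto simp: coeff_swap_vars)
  note top = resultant_sub_top_coeffs[OF total_degree_le_pencil_poly[OF deg(1,2)]
      total_degree_le_lift_t[OF deg(3)] m_pos n_pos, unfolded R]
  obtain s :: "complex poly" where s: "s = 1 \<or> s = -1"
    and rev: "\<And>A B A' B' U V U' V'. \<lbrakk>\<forall>k\<le>m. coeff A' k = coeff A (m - k); \<forall>k\<le>n. coeff B' k = coeff B (n - k);
        \<forall>k\<le>m. coeff U' k = coeff U (m - k); \<forall>k\<le>n. coeff V' k = coeff V (n - k)\<rbrakk> \<Longrightarrow>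
       resultant_sub m n A' B' = s * resultant_sub m n A B \<and>
       det_variation (m + n) (syl A' B') (syl U' V') = s * det_variation (m + n) (syl A B) (syl U V)"
    using sylvester_reverse[of m n, where 'a = "complex poly"] by (elim exE conjE) (rule that, assumption, blast)
  have "resultant_sub m n (homog_part m ?p) (homog_part n ?q) = s * lead \<and>
    det_variation (m + n) (syl (homog_part m ?p) (homog_part n ?q)) (syl (homog_part (m - 1) ?p) (homog_part (n - 1) ?q))
      = s * sub_y"
    unfolding lead_def sub_y_def
  proof (rule rev)
    show "\<forall>k\<le>m. coeff (homog_part m ?p) k = coeff (P m) (m - k)"
      by (simp add: coeff_homog_part swap_vars_pencil)
    show "\<forall>k\<le>n. coeff (homog_part n ?q) k = coeff (Q n) (n - k)"
      by (simp add: coeff_homog_part swap_vars_pencil)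
    show "\<forall>k\<le>m. coeff (homog_part (m - 1) ?p) k = coeff (pCons 0 (P (m - 1))) (m - k)"
      using m_pos by (auto simp: coeff_homog_part swap_vars_pencil coeff_pCons split: nat.splits
          intro!: arg_cong2[of _ _ _ _ coeff] arg_cong[of _ _ "coeff (pencil_poly h1 h2)"])
    show "\<forall>k\<le>n. coeff (homog_part (n - 1) ?q) k = coeff (pCons 0 (Q (n - 1))) (n - k)"
      using n_pos by (auto simp: coeff_homog_part swap_vars_pencil coeff_pCons split: nat.splits
          intro!: arg_cong2[of _ _ _ _ coeff] arg_cong[of _ _ "coeff (lift_t f)"])
  qed
  note sb = this[THEN conjunct1] this[THEN conjunct2]
  \<comment> \<open>The sign introduced by the reversal is moved into the constant.\<close>
  obtain e :: complex where e: "e = 1 \<and> s = 1 \<or> e = -1 \<and> s = -1"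
    using s by blast
  then have ee: "Polynomial.smult e (s * x) = x" for x by auto
  have "Polynomial.smult (e * c) (coeff ?R (m * n)) = Polynomial.smult e (coeff (Polynomial.smult [:c:] ?R) (m * n))"
    by simp
  also have "\<dots> = lead" unfolding top(2) sb(1) by (rule ee)
  finally have 1: "Polynomial.smult (e * c) (coeff ?R (m * n)) = lead" .
  have "Polynomial.smult (e * c) (coeff (pCons 0 ?R) (m * n)) =
      Polynomial.smult e (coeff (pCons 0 (Polynomial.smult [:c:] ?R)) (m * n))"
    by (cases "m * n") auto
  also have "\<dots> = sub_y" unfolding top(3) sb(2) by (rule ee)
  finally have 2: "Polynomial.smult (e * c) (coeff (pCons 0 ?R) (m * n)) = sub_y" .
  show ?thesis using that[of "e * c"] 1 2 c e top(1) by auto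
qed

lemma degree_top_f: "degree (homog_part n f) = n"
  using degree_homog_part[of n f] y_power
  by (intro antisym le_degree) (auto simp: coeff_homog_part)

lemma eval_Q: "map_poly (\<lambda>c. poly c t) (Q n) = homog_part n f"
  by (rule poly_eqI) (simp add: coeff_map_poly coeff_homog_part coeff_lift_t)

lemma eval_P: "poly (map_poly (\<lambda>c. poly c t) (P m)) \<beta> =
   poly (homog_part m h1) \<beta> + t * poly (homog_part m h2) \<beta>"
proof -
  have "map_poly (\<lambda>c. poly c t) (P m) = homog_part m h1 + Polynomial.smult t (homog_part m h2)"
    by (rule poly_eqI) (simp add: coeff_map_poly coeff_homog_part coeff_pencil_poly)
  then show ?thesis by simp
qed

lemma degree_eval: "degree (map_poly (\<lambda>c. poly c t) (homog_part k p)) \<le> k"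
  using degree_map_poly_le degree_homog_part order_trans by metis

lemma lead_root_iff: "poly lead t = 0 \<longleftrightarrow>
   (\<exists>\<beta>. poly (homog_part n f) \<beta> = 0 \<and> poly (homog_part m h1) \<beta> + t * poly (homog_part m h2) \<beta> = 0)"
proof
  assume "poly lead t = 0"
  then have "resultant_sub m n (map_poly (\<lambda>c. poly c t) (P m)) (homog_part n f) = 0"
    by (simp add: lead_def poly_resultant_sub eval_Q)
  from resultant_sub_eq_0_imp_common_root[OF degree_eval degree_top_f n_pos this]
  show "\<exists>\<beta>. poly (homog_part n f) \<beta> = 0 \<and> poly (homog_part m h1) \<beta> + t * poly (homog_part m h2) \<beta> = 0"
    by (auto simp: eval_P)
next
  assume "\<exists>\<beta>. poly (homog_part n f) \<beta> = 0 \<and> poly (homog_part m h1) \<beta> + t * poly (homog_part m h2) \<beta> = 0"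
  then obtain \<beta> where "poly (homog_part n f) \<beta> = 0" "poly (map_poly (\<lambda>c. poly c t) (P m)) \<beta> = 0"
    by (auto simp: eval_P)
  then show "poly lead t = 0"
    unfolding lead_def poly_resultant_sub eval_Q
    by (intro resultant_sub_eq_0_if_common_root[where \<beta> = \<beta>]) (use m_pos degree_eval degree_homog_part in auto)
qed

lemma direction_at_root:
  assumes "poly (homog_part n f) \<beta> = 0" "poly (homog_part m h1) \<beta> + t * poly (homog_part m h2) \<beta> = 0"
  shows "poly sub_y t = \<beta> * poly sub_x t"
proof -
  let ?e = "map_poly (\<lambda>c. poly c t)"
  have e0: "?e (pCons 0 U) = pCons 0 (?e U)" for U
    by (rule poly_eqI) (simp add: coeff_map_poly coeff_pCons split: nat.split)
  have ev: "poly (det_variation (m + n) (syl U V) (syl U' V')) t =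
     det_variation (m + n) (\<lambda>i j. sylvester_mat_sub m n (?e U) (?e V) $$ (i, j))
        (\<lambda>i j. sylvester_mat_sub m n (?e U') (?e V') $$ (i, j))" for U V U' V'
    unfolding poly_det_variation by (rule det_variation_cong) (simp_all add: poly_sylvester)
  have deg: "degree (?e (homog_part (k - 1) p)) < k" if "k > 0" for k p
    using degree_eval[of t "k - 1" p] that by linarith
  have root: "poly (?e (P m)) \<beta> = 0" "poly (?e (Q n)) \<beta> = 0"
    using assms by (simp_all add: eval_P eval_Q)
  show ?thesis
    unfolding sub_x_def sub_y_def ev e0
    by (rule sylvester_variation_direction[OF degree_eval degree_eval root deg[OF m_pos] deg[OF n_pos]])
qed

lemma coeff_P: "coeff (P k) j = [:coeff (homog_part k h1) j, coeff (homog_part k h2) j:]"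
  and coeff_Q: "coeff (Q k) j = [:coeff (homog_part k f) j:]"
  by (auto simp: coeff_homog_part coeff_pencil_poly coeff_lift_t)

lemma degree_lead: "degree lead = n"
proof -
  have P: "degree (coeff (P m) k) \<le> 1" and Q: "degree (coeff (Q n) k) = 0" for k
    by (simp_all add: coeff_P coeff_Q)
  have "map_poly (\<lambda>c. coeff c 1) (P m) = homog_part m h2" "map_poly (\<lambda>c. coeff c 0) (Q n) = homog_part n f"
    by (auto intro!: poly_eqI simp: coeff_map_poly coeff_P coeff_Q)
  then have "coeff lead n = resultant_sub m n (homog_part m h2) (homog_part n f)"
    unfolding lead_def resultant_sub_pencil(2)[OF P Q] by simp
  also have "\<dots> \<noteq> 0"
    using resultant_sub_eq_0_imp_common_root[OF degree_homog_part degree_top_f n_pos] no_base_point by blast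
  finally have "n \<le> degree lead" by (rule le_degree)
  moreover have "degree lead \<le> n" unfolding lead_def by (rule resultant_sub_pencil(1)[OF P Q])
  ultimately show ?thesis by simp
qed

lemma degree_variation_pencil:
  assumes "\<And>k. degree (coeff U k) \<le> 1" "\<And>k. degree (coeff V k) = 0"
  shows "degree (det_variation (m + n) (syl (P m) (Q n)) (syl U V)) \<le> n"
proof -
  have "(\<Sum>i<m+n. if i < n then 1 else 0) = (\<Sum>i<n. 1 :: nat)"
    by (rule sum.mono_neutral_cong_right) auto
  then have "(\<Sum>i<m+n. if i < n then 1 else 0 :: nat) = n" by simp
  moreover have "degree (det_variation (m + n) (syl (P m) (Q n)) (syl U V)) \<le> (\<Sum>i<m+n. if i < n then 1 else 0)"
    by (rule degree_det_variation) (use assms in \<open>auto simp: sylvester_mat_sub_index coeff_P coeff_Q\<close>)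
  ultimately show ?thesis by simp
qed

text \<open>
  Each zero \<open>(1 : \<gamma>)\<close> of the top form of \<open>f\<close> is a common zero with the top form of \<open>h\<^sub>1 + t h\<^sub>2\<close> for
  exactly one \<open>t\<close>, and at this \<open>t\<close> the coefficients \<open>sub_x\<close> and \<open>sub_y\<close> are in the ratio \<open>1 : \<gamma>\<close>.
\<close>

lemma form_value_f_eq_0_iff:
  assumes nz: "\<And>t. poly lead t = 0 \<Longrightarrow> poly sub_x t \<noteq> 0" and dir: "(\<alpha>, \<beta>) \<noteq> (0, 0)"
  shows "form_value n f \<alpha> \<beta> = 0 \<longleftrightarrow> (\<exists>t. poly lead t = 0 \<and> \<beta> * poly sub_x t = \<alpha> * poly sub_y t)"
proof
  assume 0: "form_value n f \<alpha> \<beta> = 0"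
  have "\<alpha> \<noteq> 0"
  proof
    assume \<alpha>: "\<alpha> = 0"
    have "form_value n f \<alpha> \<beta> = (\<Sum>j\<le>n. if j = n then coeff (coeff f n) 0 * \<beta> ^ n else 0)"
      unfolding form_value_def \<alpha> by (intro sum.cong refl) auto
    then show False using 0 y_power dir \<alpha> by simp
  qed
  define \<gamma> where "\<gamma> = \<beta> / \<alpha>"
  have \<beta>: "\<beta> = \<alpha> * \<gamma>" using \<open>\<alpha> \<noteq> 0\<close> by (simp add: \<gamma>_def)
  have "form_value n f \<alpha> \<beta> = \<alpha> ^ n * poly (homog_part n f) \<gamma>"
    using form_value_scale[of n f \<alpha> 1 \<gamma>] by (simp add: \<beta> form_value_1)
  then have root: "poly (homog_part n f) \<gamma> = 0" using 0 \<open>\<alpha> \<noteq> 0\<close> by simp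
  \<comment> \<open>The member of the pencil whose top form vanishes at \<open>(1, \<gamma>)\<close>.\<close>
  define t where "t = - poly (homog_part m h1) \<gamma> / poly (homog_part m h2) \<gamma>"
  have t: "poly (homog_part m h1) \<gamma> + t * poly (homog_part m h2) \<gamma> = 0"
    using no_base_point[OF root] by (simp add: t_def)
  have "poly lead t = 0" using lead_root_iff root t by blast
  moreover have "\<beta> * poly sub_x t = \<alpha> * poly sub_y t" by (simp add: \<beta> direction_at_root[OF root t])
  ultimately show "\<exists>t. poly lead t = 0 \<and> \<beta> * poly sub_x t = \<alpha> * poly sub_y t" by blast
next
  assume "\<exists>t. poly lead t = 0 \<and> \<beta> * poly sub_x t = \<alpha> * poly sub_y t"
  then obtain t where t: "poly lead t = 0" "\<beta> * poly sub_x t = \<alpha> * poly sub_y t" by blast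
  then obtain \<gamma> where root: "poly (homog_part n f) \<gamma> = 0"
    and "poly (homog_part m h1) \<gamma> + t * poly (homog_part m h2) \<gamma> = 0" using lead_root_iff by blast
  then have "poly sub_y t = \<gamma> * poly sub_x t" by (intro direction_at_root)
  then have "\<beta> = \<alpha> * \<gamma>" using t(2) nz[OF t(1)] by simp
  then have "form_value n f \<alpha> \<beta> = \<alpha> ^ n * poly (homog_part n f) \<gamma>"
    using form_value_scale[of n f \<alpha> 1 \<gamma>] by (simp add: form_value_1)
  then show "form_value n f \<alpha> \<beta> = 0" using root by simp
qed

lemma degree_sub: "degree sub_x \<le> n" "degree sub_y \<le> n"
  unfolding sub_x_def sub_y_def
  by (rule degree_variation_pencil; simp add: coeff_P coeff_Q coeff_pCons split: nat.split)+

end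

section \<open>Quotients by a monic factor and their roots\<close>

lemma quotient_coeffs:
  fixes S A B :: "'a :: idom poly"
  assumes "is_quotient S A B" "degree A + 1 = D" "lead_coeff A = 1" "degree S \<le> D"
  shows "degree B \<le> 1" "coeff S D = coeff B 1"
    "coeff (pCons 0 S) D = coeff (pCons 0 A) (degree A) * coeff B 1 + coeff B 0"
proof -
  obtain R where R: "S = A * B + R" "R = 0 \<or> degree R < degree A"
    using assms(1) unfolding is_quotient_def by blast
  have A: "A \<noteq> 0" using assms(3) by auto
  have "degree (S - R) \<le> D" using R(2) assms(2,4) by (intro degree_diff_le) auto
  then have "degree (A * B) \<le> D" using R(1) by simp
  then show B: "degree B \<le> 1"
    using A assms(2) by (cases "B = 0") (auto simp: degree_mult_eq)
  have D: "D = Suc (degree A)" using assms(2) by simp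
  \<comment> \<open>The remainder is of degree less than \<open>D - 1\<close>, so it does not affect the two highest
    coefficients.\<close>
  have R0: "coeff R D = 0" "coeff (pCons 0 R) D = 0"
    using R(2) by (auto simp: D coeff_eq_0)
  have "coeff (A * B) D = coeff B 1" "coeff (pCons 0 (A * B)) D = coeff (pCons 0 A) (degree A) * coeff B 1 + coeff B 0"
    using coeff_mult_at_bounds[OF order_refl B, of A] assms(3) by (simp_all add: D)
  then show "coeff S D = coeff B 1"
    "coeff (pCons 0 S) D = coeff (pCons 0 A) (degree A) * coeff B 1 + coeff B 0"
    using R(1) R0 by (simp_all add: D)
qed

text \<open>
  A common zero of \<open>b\<close> and the numerator would be a common zero of the two coefficients of \<open>B\<close>, hence
  of its content.  The constant \<open>c\<close> absorbs the difference between the resultant and its padded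
  version.
\<close>

lemma quotient_root:
  fixes S A B :: "complex poly poly" and c :: complex
  defines "a \<equiv> coeff (pCons 0 A) (degree A)"
  assumes quot: "is_quotient S A B" "degree A + 1 = D" "lead_coeff A = 1" "degree S \<le> D"
    and c: "c \<noteq> 0" "Polynomial.smult c (coeff S D) = b" "Polynomial.smult c (coeff (pCons 0 S) D) = N"
    and b: "b \<noteq> 0" and content: "degree (content B) = 0"
    and root: "poly (map_poly to_fract B) p = 0"
  shows "p * to_fract b = to_fract (a * b - N)" "\<And>t. poly b t = 0 \<Longrightarrow> poly (a * b - N) t \<noteq> 0"
proof -
  note q = quotient_coeffs[OF quot, folded a_def]
  obtain b0 b1 where B: "B = [:b0, b1:]"
  proof
    show "B = [:coeff B 0, coeff B 1:]"
      using q(1) by (intro poly_eqI) (auto simp: coeff_pCons coeff_eq_0 split: nat.split)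
  qed
  have b1: "Polynomial.smult c b1 = b" and N: "N = a * b + Polynomial.smult c b0"
    using q c by (auto simp: B smult_add_right)
  then have "b1 \<noteq> 0" using b by auto
  then have "to_fract b0 + p * to_fract b1 = 0" using root by (simp add: B map_poly_pCons)
  then have "p * to_fract b1 = - to_fract b0" by (simp add: eq_neg_iff_add_eq_0 add.commute)
  then have "to_fract [:c:] * (p * to_fract b1) = to_fract [:c:] * (- to_fract b0)" by simp
  then have "p * to_fract ([:c:] * b1) = - to_fract ([:c:] * b0)"
    by (simp only: to_fract_mult mult_minus_right mult.left_commute)
  then show "p * to_fract b = to_fract (a * b - N)" using b1 N by simp
  fix t assume t: "poly b t = 0"
  show "poly (a * b - N) t \<noteq> 0"
  proof
    assume "poly (a * b - N) t = 0"
    then have "poly b0 t = 0" "poly b1 t = 0" using t b1 N c(1) by auto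
    then have "[:-t, 1:] dvd b0" "[:-t, 1:] dvd b1" by (simp_all add: poly_eq_0_iff_dvd)
    then have "[:[:-t, 1:]:] dvd B" by (auto simp: B const_poly_dvd_iff coeff_pCons split: nat.split)
    then have "[:-t, 1:] dvd content B" by (simp add: const_poly_dvd_iff_dvd_content)
    moreover have "content B \<noteq> 0" using \<open>b1 \<noteq> 0\<close> by (simp add: B)
    ultimately have "degree [:-t, 1:] \<le> degree (content B)" by (rule dvd_imp_degree_le)
    then show False using content by simp
  qed
qed

text \<open>
  The curve is defined by the normalized numerator and denominator.  Since \<open>n\<close> and \<open>b\<close> have no common
  zero, the fraction \<open>n / b\<close> has the same values and the same poles.
\<close>

lemma quot_of_fract_values:
  fixes n b :: "complex poly"
  assumes p: "p * to_fract b = to_fract n" and b: "b \<noteq> 0" and cop: "\<forall>t. poly b t = 0 \<longrightarrow> poly n t \<noteq> 0"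
  shows "poly (snd (quot_of_fract p)) t = 0 \<longleftrightarrow> poly b t = 0"
    and "poly b t \<noteq> 0 \<Longrightarrow> poly (fst (quot_of_fract p)) t / poly (snd (quot_of_fract p)) t = poly n t / poly b t"
proof -
  obtain u v where uv: "quot_of_fract p = (u, v)" by force
  have cuv: "coprime u v" using coprime_quot_of_fract[of p] uv by simp
  have v: "v \<noteq> 0" using snd_quot_of_fract_nonzero[of p] uv by simp
  have "p = to_fract u / to_fract v"
    using Fract_quot_of_fract[of p] uv by (simp add: Fract_conv_to_fract)
  then have up: "p * to_fract v = to_fract u" using v by simp
  have "to_fract (u * b) = p * to_fract b * to_fract v" by (simp only: to_fract_mult mult_ac flip: up)
  then have "to_fract (u * b) = to_fract (n * v)" by (simp only: p to_fract_mult)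
  then have eq: "u * b = n * v" by (simp only: to_fract_eq_iff)
  have "poly v t = 0 \<Longrightarrow> poly b t = 0" for t
  proof -
    have "v dvd u * b" using eq by simp
    then have "v dvd b" using cuv by (simp add: coprime_dvd_mult_right_iff coprime_commute)
    then show "poly v t = 0 \<Longrightarrow> poly b t = 0" by (auto elim!: dvdE)
  qed
  moreover have "poly b t = 0 \<Longrightarrow> poly v t = 0" for t
    using cop[rule_format, of t] arg_cong[OF eq, of "\<lambda>g. poly g t"] by simp
  ultimately have iff: "poly v t = 0 \<longleftrightarrow> poly b t = 0" for t by blast
  then show "poly (snd (quot_of_fract p)) t = 0 \<longleftrightarrow> poly b t = 0" using uv by simp
  show "poly (fst (quot_of_fract p)) t / poly (snd (quot_of_fract p)) t = poly n t / poly b t" if "poly b t \<noteq> 0"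
    using that iff[of t] arg_cong[OF eq, of "\<lambda>g. poly g t"] uv by (simp add: field_simps)
qed
text \<open>
  The inner variable is \<open>t\<close>, so the last condition says that \<open>A\<close> does not depend on \<open>t\<close>.
\<close>

definition constant_monic :: "nat \<Rightarrow> complex poly poly \<Rightarrow> bool" where
  "constant_monic k A \<longleftrightarrow> degree A = k \<and> coeff A k = 1 \<and> (\<forall>i. degree (coeff A i) = 0)"

lemma constant_monic_1: "constant_monic 0 1"
  by (simp add: constant_monic_def coeff_1)

lemma constant_monic_linear: "constant_monic 1 [:- [:c:], 1:]"
  by (auto simp: constant_monic_def coeff_pCons split: nat.split)

lemma constant_monic_mult:
  assumes "constant_monic k A" "constant_monic l B"
  shows "constant_monic (k + l) (A * B)"
proof -
  have "A \<noteq> 0" "B \<noteq> 0" using assms by (auto simp: constant_monic_def)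
  moreover have "degree (coeff (A * B) i) = 0" for i
  proof -
    have "degree (coeff (A * B) i) \<le> 0"
      unfolding coeff_mult
    proof (intro degree_sum_le)
      fix j
      show "degree (coeff A j * coeff B (i - j)) \<le> 0"
        using degree_mult_le[of "coeff A j" "coeff B (i - j)"] assms by (simp add: constant_monic_def)
    qed simp
    then show ?thesis by simp
  qed
  ultimately show ?thesis using assms coeff_mult_at_bounds(1)[of A k B l]
    by (simp add: constant_monic_def degree_mult_eq)
qed

lemma constant_monic_power: "constant_monic k A \<Longrightarrow> constant_monic (e * k) (A ^ e)"
  by (induction e) (simp_all add: constant_monic_1 constant_monic_mult)

lemma constant_monic_prod:
  "(\<And>i. i \<in> I \<Longrightarrow> constant_monic (k i) (A i)) \<Longrightarrow> constant_monic (\<Sum>i\<in>I. k i) (\<Prod>i\<in>I. A i)"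
  by (induction I rule: infinite_finite_induct) (simp_all add: constant_monic_1 constant_monic_mult)

lemma constant_monic_prod_list:
  "(\<And>i. i \<in> set xs \<Longrightarrow> constant_monic 1 (A i)) \<Longrightarrow> constant_monic (length xs) (\<Prod>i\<leftarrow>xs. A i)"
proof (induction xs)
  case (Cons x xs)
  then have "constant_monic (1 + length xs) (A x * (\<Prod>i\<leftarrow>xs. A i))" by (intro constant_monic_mult) auto
  then show ?case by simp
qed (simp add: constant_monic_1)

text \<open>
  By \<open>\<epsilon>\<close>-rationality the clusters contribute the degree \<open>(d - 1) (d - 2)\<close>, and the simple points
  contribute \<open>d - 3\<close>; together this is one less than \<open>(d - 2) d\<close>.
\<close>

lemma constant_monic_known_factor:
  assumes "eps_rational \<epsilon> f S" "cluster_decomposition \<epsilon> f S rep"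
    and "length Ps = total_degree f - 3" "total_degree f > 2"
  shows "constant_monic ((total_degree f - 2) * total_degree f - 1) (known_factor \<epsilon> f S rep Ps pr)"
proof -
  let ?r = "\<lambda>K. eps_mult \<epsilon> f (rep K)" and ?d = "total_degree f"
  obtain e where e: "?d = e + 3" using assms(4) by (metis add.commute less_eq_Suc_le le_Suc_ex numeral_3_eq_3 numeral_2_eq_2)
  have "int (?r K * (?r K - 1)) = int (?r K) * (int (?r K) - 1)" for K by (cases "?r K") (auto simp: algebra_simps)
  then have "int (\<Sum>K\<in>clusters \<epsilon> f S. ?r K * (?r K - 1)) = (\<Sum>K\<in>clusters \<epsilon> f S. int (?r K) * (int (?r K) - 1))"
    by (simp only: of_nat_sum)
  also have "\<dots> = (int ?d - 1) * (int ?d - 2)"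
    using assms(1)[unfolded eps_rational_def, rule_format, OF assms(2)] by linarith
  also have "\<dots> = int ((e + 2) * (e + 1))" by (simp add: e algebra_simps)
  finally have sum: "(\<Sum>K\<in>clusters \<epsilon> f S. ?r K * (?r K - 1)) = (e + 2) * (e + 1)"
    by (simp only: of_nat_eq_iff)
  have "constant_monic (\<Sum>K\<in>clusters \<epsilon> f S. ?r K * (?r K - 1) * 1)
      (\<Prod>K\<in>clusters \<epsilon> f S. [:- [:pr (rep K):], 1:] ^ (?r K * (?r K - 1)))"
    by (intro constant_monic_prod constant_monic_power constant_monic_linear)
  moreover have "constant_monic (length Ps) (\<Prod>P\<leftarrow>Ps. [:- [:pr P:], 1:])"
    by (intro constant_monic_prod_list constant_monic_linear)
  ultimately have "constant_monic ((e + 2) * (e + 1) + length Ps) (known_factor \<epsilon> f S rep Ps pr)"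
    unfolding known_factor_def by (intro constant_monic_mult) (simp_all only: sum mult_1_right)
  moreover have "(e + 2) * (e + 1) + length Ps = (?d - 2) * ?d - 1"
    by (simp add: assms(3) e algebra_simps)
  ultimately show ?thesis by simp
qed

section \<open>Forms of the pencil of adjoint curves\<close>

lemma total_degree_le_mono2: "i + j \<le> m \<Longrightarrow> total_degree_le m (mono2 c i j)"
  by (auto simp: total_degree_le_def mono2_def coeff_monom split: if_splits)

lemma total_degree_le_perturbation:
  assumes "d > 2"
  shows "total_degree_le (d - 2) (perturbation d \<delta>)"
  using assms unfolding perturbation_def
  by (auto intro!: total_degree_le_add total_degree_le_mono2)

lemma homogeneous_mono3: "i + j + k = m \<Longrightarrow> homogeneous m (mono3 c i j k)"
  by (auto simp: homogeneous_def mono3_def mono2_def coeff_monom split: if_splits)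

lemma homogeneous_add: "homogeneous m G \<Longrightarrow> homogeneous m H \<Longrightarrow> homogeneous m (G + H)"
  unfolding homogeneous_def by (metis add.right_neutral coeff_add)

lemma coeff_dehomogenization:
  "coeff (coeff (poly H 1) j) i = (\<Sum>k\<le>degree H. coeff (coeff (coeff H k) j) i)"
  by (simp add: poly_altdef coeff_sum)

lemma total_degree_le_dehomogenization:
  assumes "homogeneous m H"
  shows "total_degree_le m (poly H 1)"
  unfolding total_degree_le_def
proof (intro allI impI)
  fix i j assume "coeff (coeff (poly H 1) j) i \<noteq> 0"
  then obtain k where "coeff (coeff (coeff H k) j) i \<noteq> 0"
    unfolding coeff_dehomogenization by (meson sum.not_neutral_contains_not_neutral)
  then have "i + j + k = m" using assms by (simp add: homogeneous_def)
  then show "i + j \<le> m" by simp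
qed

lemma homog_part_dehomogenization:
  assumes "homogeneous m H"
  shows "homog_part m (poly H 1) = homog_part m (poly H 0)"
proof (rule poly_eqI)
  fix j
  have "coeff (coeff (poly H 1) j) (m - j) = (\<Sum>k\<le>degree H. if k = 0 then coeff (coeff (coeff H k) j) (m - j) else 0)"
    if "j \<le> m" unfolding coeff_dehomogenization
  proof (intro sum.cong refl)
    fix k
    have *: "coeff (coeff (coeff H k) j) (m - j) \<noteq> 0 \<Longrightarrow> (m - j) + j + k = m"
      using assms unfolding homogeneous_def by blast
    have "(m - j) + j + k \<noteq> m" if "k \<noteq> 0" using \<open>j \<le> m\<close> that by simp
    with * show "coeff (coeff (coeff H k) j) (m - j) = (if k = 0 then coeff (coeff (coeff H k) j) (m - j) else 0)"
      by meson
  qed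
  then show "coeff (homog_part m (poly H 1)) j = coeff (homog_part m (poly H 0)) j"
    by (simp add: coeff_homog_part poly_0_coeff_0)
qed

lemma poly_poly_eq_eval2: "poly (poly F g) x = eval2 F (x, poly g x)"
  by (induction F) (simp_all add: eval2_def)

text \<open>
  Substituting \<open>y = \<beta> x\<close> in a form of degree \<open>k\<close> gives \<open>x\<^sup>k\<close> times its value at \<open>(1, \<beta>)\<close>, which is zero,
  so the linear form \<open>y - \<beta> x\<close> divides it.
\<close>

lemma linear_factor_of_form:
  fixes F :: poly2
  assumes hom: "\<And>i j. coeff (coeff F j) i \<noteq> 0 \<Longrightarrow> i + j = k" and root: "poly (homog_part k F) \<beta> = 0"
  shows "[:- [:0, \<beta>:], 1:] dvd F"
proof -
  have le: "total_degree_le k F" using hom by (fastforce simp: total_degree_le_def)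
  have "poly (poly F [:0, \<beta>:]) x = 0" for x
  proof -
    have "poly (poly F [:0, \<beta>:]) x = (\<Sum>l\<le>k. form_value l F x (x * \<beta>))"
      by (simp add: poly_poly_eq_eval2 eval2_eq_sum_forms[OF le])
    also have "\<dots> = (\<Sum>l\<le>k. 0)"
    proof (intro sum.cong refl)
      fix l assume "l \<in> {..k}"
      show "form_value l F x (x * \<beta>) = 0"
      proof (cases "l = k")
        case True
        then show ?thesis using form_value_scale[of k F x 1 \<beta>] root by (simp add: form_value_1)
      next
        case False
        have "coeff (coeff F j) (l - j) = 0" if "j \<le> l" for j
          using hom[of j "l - j"] False that by auto
        then show ?thesis unfolding form_value_def by (intro sum.neutral) auto
      qed
    qed
    finally show ?thesis by simp
  qed
  then have "poly F [:0, \<beta>:] = 0" using poly_all_0_iff_0 by blast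
  then show ?thesis by (simp add: poly_eq_0_iff_dvd)
qed

lemma coprime_forms_no_common_root:
  fixes F G :: poly2
  assumes "coprime F G" "\<And>i j. coeff (coeff F j) i \<noteq> 0 \<Longrightarrow> i + j = k" "\<And>i j. coeff (coeff G j) i \<noteq> 0 \<Longrightarrow> i + j = l"
    and "poly (homog_part k F) \<beta> = 0"
  shows "poly (homog_part l G) \<beta> \<noteq> 0"
proof
  assume root: "poly (homog_part l G) \<beta> = 0"
  have "[:- [:0, \<beta>:], 1:] dvd (1 :: poly2)"
    by (rule coprime_common_divisor[OF assms(1)])
      (rule linear_factor_of_form[OF assms(2,4)] linear_factor_of_form[OF assms(3) root], assumption)+
  from dvd_imp_degree_le[OF this] show False by simp
qed

lemma pencil_members:
  assumes "pencil L G1 G2"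
  shows "G1 \<in> L" "G2 \<in> L"
proof -
  have L: "L = {Polynomial.smult [:[:a:]:] G1 + Polynomial.smult [:[:b:]:] G2 | a b. True}"
    using assms by (simp add: pencil_def)
  have one: "[:[:1::complex:]:] = 1" by (simp only: pCons_one)
  have "Polynomial.smult [:[:1:]:] G1 + Polynomial.smult [:[:0:]:] G2 \<in> L" unfolding L by blast
  then show "G1 \<in> L" by (simp add: one)
  have "Polynomial.smult [:[:0:]:] G1 + Polynomial.smult [:[:1:]:] G2 \<in> L" unfolding L by blast
  then show "G2 \<in> L" by (simp add: one)
qed

lemma base_pencil_homogeneous:
  assumes "base_pencil \<epsilon> f S rep Ps Ps' G1 G2"
  shows "homogeneous (total_degree f - 2) G1" "homogeneous (total_degree f - 2) G2" "length Ps' = length Ps"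
proof -
  obtain X where "pencil (through (adjoint_system \<epsilon> f S rep) X) G1 G2"
    using assms unfolding base_pencil_def Let_def by blast
  from pencil_members[OF this]
  show "homogeneous (total_degree f - 2) G1" "homogeneous (total_degree f - 2) G2"
    by (simp_all add: through_def adjoint_system_def)
  show "length Ps' = length Ps"
    using assms unfolding base_pencil_def Let_def by (auto dest: list_all2_lengthD)
qed

lemma normalized_pencil_homogeneous:
  assumes "normalized_pencil \<epsilon> f G1 G2 H1 H2"
    and "homogeneous (total_degree f - 2) G1" "homogeneous (total_degree f - 2) G2"
  shows "homogeneous (total_degree f - 2) H1" "homogeneous (total_degree f - 2) H2"
    "coprime (poly (homogenization f) 0) (poly H2 0)"
  using assms unfolding normalized_pencil_def Let_def
  by (auto split: if_splits intro!: homogeneous_add homogeneous_mono3)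

section \<open>Points at infinity and degree of the parametrized curve\<close>

theorem theorem4p7:
  fixes \<epsilon> :: real and f :: poly2 and d :: nat and S :: "point set"
    and p1 p2 :: "complex poly fract"
  assumes "0 < \<epsilon>" "\<epsilon> < 1"
    and "real_poly f"
    and "eps_irreducible \<epsilon> f"
    and "proper_degree \<epsilon> f d" "d > 2"
    and "\<And>a b. (a, b) \<noteq> (0, 0) \<Longrightarrow> \<not> singular_point (homogenization f) a b 0"
    and "eval3 (homogenization f) 1 0 0 \<noteq> 0" "eval3 (homogenization f) 0 1 0 \<noteq> 0"
    and "eps_singular_locus \<epsilon> f S"
    and "eps_rational \<epsilon> f S"
    and "approximate_parametrization \<epsilon> f S p1 p2"
  shows "(\<exists>q. defining_polynomial q (parametrized_curve p1 p2)) \<and>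
         (\<forall>q. defining_polynomial q (parametrized_curve p1 p2) \<longrightarrow>
            points_at_infinity q = points_at_infinity f \<and> total_degree q \<le> total_degree f)"
proof -
  have d: "total_degree f = d" using \<open>proper_degree \<epsilon> f d\<close> by (simp add: proper_degree_def)
  obtain rep Ps Ps' G1 G2 H1 H2 \<delta> B1 B2 where
    rep: "cluster_decomposition \<epsilon> f S rep" and
    Ps: "simple_points \<epsilon> f S rep Ps" and
    G: "base_pencil \<epsilon> f S rep Ps Ps' G1 G2" and
    H: "normalized_pencil \<epsilon> f G1 G2 H1 H2" and
    B: "quotients \<epsilon> f S rep Ps' H1 H2 \<delta> B1 B2" and
    contents: "contents_constant B1 B2" and
    p1: "poly (map_poly to_fract B1) p1 = 0" and
    p2: "poly (map_poly to_fract B2) p2 = 0"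
    using \<open>approximate_parametrization \<epsilon> f S p1 p2\<close> unfolding approximate_parametrization_def by blast
  note G' = base_pencil_homogeneous[OF G]
  note H' = normalized_pencil_homogeneous[OF H G'(1,2)]
  define m where "m = d - 2"
  define h1 where "h1 = poly H1 1 + perturbation d \<delta>"
  define h2 where "h2 = poly H2 1"
  have F0: "homog_part d (poly (homogenization f) 0) = homog_part d f"
    by (rule poly_eqI) (simp add: coeff_homog_part coeff_homogenization_0 d)
  interpret C: curve_pencil h1 h2 f m d
  proof
    show "0 < m" "0 < d" using \<open>d > 2\<close> by (simp_all add: m_def)
    show "total_degree_le m h1"
      unfolding h1_def m_def using H'(1) \<open>d > 2\<close>
      by (intro total_degree_le_add total_degree_le_dehomogenization total_degree_le_perturbation) (simp_all add: d)
    show "total_degree_le m h2"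
      unfolding h2_def m_def using H'(2) by (intro total_degree_le_dehomogenization) (simp add: d)
    show "total_degree_le d f" using total_degree_le_self[of f] d by simp
    have "form_value d f 0 1 = (\<Sum>j\<le>d. if j = d then coeff (coeff f d) 0 else 0)"
      unfolding form_value_def by (intro sum.cong refl) auto
    then show "coeff (coeff f d) 0 \<noteq> 0"
      using \<open>eval3 (homogenization f) 0 1 0 \<noteq> 0\<close> by (simp add: eval3_homogenization_0 d)
    have "form_value d f 1 0 = (\<Sum>j\<le>d. if j = 0 then coeff (coeff f 0) d else 0)"
      unfolding form_value_def by (intro sum.cong refl) auto
    then show "coeff (coeff f 0) d \<noteq> 0"
      using \<open>eval3 (homogenization f) 1 0 0 \<noteq> 0\<close> by (simp add: eval3_homogenization_0 d)
    fix \<beta> assume "poly (homog_part d f) \<beta> = 0"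
    then have root: "poly (homog_part d (poly (homogenization f) 0)) \<beta> = 0" by (simp only: F0)
    have "poly (homog_part m (poly H2 0)) \<beta> \<noteq> 0"
    proof (rule coprime_forms_no_common_root[OF H'(3) _ _ root])
      show "i + j = d" if "coeff (coeff (poly (homogenization f) 0) j) i \<noteq> 0" for i j
        using that unfolding coeff_homogenization_0 d by presburger
      show "i + j = m" if "coeff (coeff (poly H2 0) j) i \<noteq> 0" for i j
        using that H'(2) unfolding homogeneous_def poly_0_coeff_0 d m_def by fastforce
    qed
    then show "poly (homog_part m h2) \<beta> \<noteq> 0"
      unfolding h2_def m_def d[symmetric] homog_part_dehomogenization[OF H'(2)] .
  qed
  have "length Ps' = total_degree f - 3"
    using Ps G'(3) by (simp add: simple_points_def admissible_points_def)
  note A = constant_monic_known_factor[OF \<open>eps_rational \<epsilon> f S\<close> rep this, unfolded d, OF \<open>d > 2\<close>]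
  let ?A = "known_factor \<epsilon> f S rep Ps'"
  have md: "m * d > 0" using C.m_pos C.n_pos by simp
  have A': "degree (?A pr) + 1 = m * d" "lead_coeff (?A pr) = 1" for pr
    using A[of pr] md by (simp_all add: constant_monic_def m_def)
  have quot: "is_quotient (pencil_resultant h1 h2 f) (?A fst) B1"
    "is_quotient (pencil_resultant (swap_vars h1) (swap_vars h2) (swap_vars f)) (?A snd) B2"
    using B by (simp_all add: quotients_def Let_def h1_def h2_def d)
  have b: "C.lead \<noteq> 0" using C.degree_lead C.n_pos by auto
  have content: "degree (content B1) = 0" "degree (content B2) = 0"
    using contents by (simp_all add: contents_constant_def)
  define a where "a pr = coeff (pCons 0 (?A pr)) (degree (?A pr))" for pr
  have dega: "degree (a pr) = 0" for pr
    using A[of pr] by (simp add: a_def constant_monic_def coeff_pCons split: nat.split)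
  obtain c1 where c1: "c1 \<noteq> 0" "degree (pencil_resultant h1 h2 f) \<le> m * d"
    "Polynomial.smult c1 (coeff (pencil_resultant h1 h2 f) (m * d)) = C.lead"
    "Polynomial.smult c1 (coeff (pCons 0 (pencil_resultant h1 h2 f)) (m * d)) = C.sub_x"
    using C.x_resultant .
  note x = quotient_root[OF quot(1) A' c1(2,1,3,4) b content(1) p1, folded a_def]
  let ?S2 = "pencil_resultant (swap_vars h1) (swap_vars h2) (swap_vars f)"
  obtain c2 where c2: "c2 \<noteq> 0" "degree ?S2 \<le> m * d"
    "Polynomial.smult c2 (coeff ?S2 (m * d)) = C.lead"
    "Polynomial.smult c2 (coeff (pCons 0 ?S2) (m * d)) = C.sub_y"
    using C.y_resultant .
  note y = quotient_root[OF quot(2) A' c2(2,1,3,4) b content(2) p2, folded a_def]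
  define n1 where "n1 = a fst * C.lead - C.sub_x"
  define n2 where "n2 = a snd * C.lead - C.sub_y"
  have deg: "degree (a pr * C.lead) \<le> d" for pr
    using degree_mult_le[of "a pr" C.lead] dega[of pr] C.degree_lead by simp
  interpret R: rational_curve n1 n2 C.lead d
    by unfold_locales
      (use C.degree_lead C.n_pos deg C.degree_sub x(2) in \<open>auto simp: n1_def n2_def intro!: degree_diff_le\<close>)
  have x': "p1 * to_fract C.lead = to_fract n1" "\<forall>t. poly C.lead t = 0 \<longrightarrow> poly n1 t \<noteq> 0"
    and y': "p2 * to_fract C.lead = to_fract n2" "\<forall>t. poly C.lead t = 0 \<longrightarrow> poly n2 t \<noteq> 0"
    using x y by (simp_all add: n1_def n2_def)
  note qx = quot_of_fract_values[OF x'(1) b x'(2)] and qy = quot_of_fract_values[OF y'(1) b y'(2)]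
  have curve: "parametrized_curve p1 p2 = zariski_closure R.curve_points"
    unfolding parametrized_curve_def R.curve_points_def
  proof (intro arg_cong[of _ _ zariski_closure] Collect_cong ex_cong1)
    fix P t
    show "(P = (poly (fst (quot_of_fract p1)) t / poly (snd (quot_of_fract p1)) t,
           poly (fst (quot_of_fract p2)) t / poly (snd (quot_of_fract p2)) t) \<and>
         poly (snd (quot_of_fract p1)) t \<noteq> 0 \<and> poly (snd (quot_of_fract p2)) t \<noteq> 0) =
        (P = (poly n1 t / poly C.lead t, poly n2 t / poly C.lead t) \<and> poly C.lead t \<noteq> 0)"
      unfolding qx(1) qy(1) by (cases "poly C.lead t = 0") (simp_all only: qx(2) qy(2) simp_thms)
  qed
  have N: "poly C.lead t = 0 \<Longrightarrow> poly C.sub_x t = - poly n1 t \<and> poly C.sub_y t = - poly n2 t" for t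
    by (simp add: n1_def n2_def)
  \<comment> \<open>At the zeros of the common denominator the numerators agree with \<open>- sub_x\<close> and \<open>- sub_y\<close>.\<close>
  have inf_f: "form_value (total_degree f) f \<alpha> \<beta> = 0 \<longleftrightarrow> (\<exists>t. poly C.lead t = 0 \<and> \<beta> * poly n1 t = \<alpha> * poly n2 t)"
    if "(\<alpha>, \<beta>) \<noteq> (0, 0)" for \<alpha> \<beta>
  proof -
    have "poly C.lead t = 0 \<Longrightarrow> poly C.sub_x t \<noteq> 0" for t using N[of t] x'(2) by simp
    from C.form_value_f_eq_0_iff[OF this that] show ?thesis
      unfolding d by (simp add: N cong: conj_cong)
  qed
  obtain q0 where q0: "irreducible q0" "R.vanishes q0" using R.irreducible_exists .
  show ?thesis
  proof (intro conjI exI allI impI)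
    show "defining_polynomial q0 (parametrized_curve p1 p2)"
      unfolding defining_polynomial_def curve using q0 R.zero_set_eq_closure by blast
    fix q assume "defining_polynomial q (parametrized_curve p1 p2)"
    then have q: "irreducible q" "R.vanishes q"
      unfolding defining_polynomial_def curve using R.vanishes_if_zero_set_eq_closure by blast+
    show "total_degree q \<le> total_degree f" using R.total_degree_le_d[OF q] d by simp
    have "form_value (total_degree q) q \<alpha> \<beta> = 0 \<longleftrightarrow> form_value (total_degree f) f \<alpha> \<beta> = 0"
      if "(\<alpha>, \<beta>) \<noteq> (0, 0)" for \<alpha> \<beta>
      unfolding R.form_value_eq_0_iff[OF q that] inf_f[OF that] ..
    then show "points_at_infinity q = points_at_infinity f"
      unfolding points_at_infinity_eq by blast
  qed
qed

end
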